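(* Let $H$ be a complex Hilbert space with $\dim H\geq 2$. Let $\phi:\mathcal{E}(H)\to\mathcal{E}(H)$ be a bijective function such that for all $A,B,C\in\mathcal{E}(H)$ \[ A \text{ is a mixture of } B \text{ and } C \Longleftrightarrow \phi(A) \text{ is a mixture of } \phi(B) \text{ and } \phi(C). \] Then there exists an operator $U$ on $H$ which is either unitary or antiunitary such that either \[ \phi(A)=UAU^* \qquad \text{for all } A\in\mathcal{E}(H), \] or \[ \phi(A)=U(I-A)U^* \qquad \text{for all } A\in\mathcal{E}(H). \]
   Context: For a complex Hilbert space $H$, $\mathcal{E}(H)$ denotes the set of all effects on $H$, i.e. the operator interval $[0,I]$ of all bounded self-adjoint operators $E$ on $H$ with $0\leq E\leq I$. An effect $A$ is called a mixture of effects $B,C$ if there is a scalar $\lambda\in[0,1]$ such that $A=\lambda B+(1-\lambda)C$. An antiunitary operator is a conjugate-linear surjective isometry $U:H\to H$; for $U$ unitary or antiunitary, $U^*=U^{-1}$. *)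

theory Defs
  imports "HOL-Analysis.Bounded_Linear_Function"
begin

class complex_vector = real_vector +
  fixes scaleC :: "complex \<Rightarrow> 'a \<Rightarrow> 'a"  (infixr \<open>*\<^sub>C\<close> 75)
  assumes scaleC_add_right: "c *\<^sub>C (x + y) = c *\<^sub>C x + c *\<^sub>C y"
    and scaleC_add_left: "(c + d) *\<^sub>C x = c *\<^sub>C x + d *\<^sub>C x"
    and scaleC_scaleC: "c *\<^sub>C d *\<^sub>C x = (c * d) *\<^sub>C x"
    and scaleC_one: "1 *\<^sub>C x = x"
    and scaleR_scaleC: "r *\<^sub>R x = complex_of_real r *\<^sub>C x"

global_interpretation complex_vector: vector_space "scaleC :: complex \<Rightarrow> 'a \<Rightarrow> 'a::complex_vector"
  by standard (simp_all add: scaleC_add_right scaleC_add_left scaleC_scaleC scaleC_one)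

text \<open>The inner product is linear in its first argument. The norm axioms inherited from
  \<^class>\<open>real_normed_vector\<close> follow from the inner product axioms; inheriting them makes the
  library's theory of real normed spaces available.\<close>

class complex_inner = complex_vector + real_normed_vector +
  fixes cinner :: "'a \<Rightarrow> 'a \<Rightarrow> complex"
  assumes cinner_add_left: "cinner (x + y) z = cinner x z + cinner y z"
    and cinner_scaleC_left: "cinner (c *\<^sub>C x) y = c * cinner x y"
    and cinner_commute: "cinner x y = cnj (cinner y x)"
    and cinner_ge_zero: "0 \<le> Re (cinner x x)"
    and cinner_eq_zero_iff: "cinner x x = 0 \<longleftrightarrow> x = 0"
    and norm_eq_sqrt_cinner: "norm x = sqrt (Re (cinner x x))"

class chilbert_space = complex_inner + complete_space

text \<open>The dimension may be infinite, which rules out \<^term>\<open>complex_vector.dim\<close>: it is \<open>0\<close> then.\<close>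

definition complex_dim_ge :: "'a::complex_vector itself \<Rightarrow> nat \<Rightarrow> bool" where
  "complex_dim_ge _ n \<longleftrightarrow>
     (\<exists>B::'a set. finite B \<and> card B = n \<and> complex_vector.independent B)"

text \<open>The type \<^typ>\<open>'a \<Rightarrow>\<^sub>L 'a\<close> consists of the bounded \<^emph>\<open>real\<close>-linear operators, so complex
  linearity is a separate requirement.\<close>

definition self_adjoint :: "('a::complex_inner \<Rightarrow>\<^sub>L 'a) \<Rightarrow> bool" where
  "self_adjoint A \<longleftrightarrow> Vector_Spaces.linear scaleC scaleC (blinfun_apply A) \<and>
     (\<forall>x y. cinner (A x) y = cinner x (A y))"

text \<open>The order is used only between self-adjoint operators, whose quadratic forms are real.\<close>

definition op_le :: "('a::complex_inner \<Rightarrow>\<^sub>L 'a) \<Rightarrow> ('a \<Rightarrow>\<^sub>L 'a) \<Rightarrow> bool" where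
  "op_le A B \<longleftrightarrow> (\<forall>x. Re (cinner (A x) x) \<le> Re (cinner (B x) x))"

definition effects :: "('a::complex_inner \<Rightarrow>\<^sub>L 'a) set" where
  "effects = {E. self_adjoint E \<and> op_le 0 E \<and> op_le E id_blinfun}"

definition mixture :: "'b::real_vector \<Rightarrow> 'b \<Rightarrow> 'b \<Rightarrow> bool" where
  "mixture A B C \<longleftrightarrow> (\<exists>t\<in>{0..1::real}. A = t *\<^sub>R B + (1 - t) *\<^sub>R C)"

definition unitary :: "('a::complex_inner \<Rightarrow> 'a) \<Rightarrow> bool" where
  "unitary U \<longleftrightarrow> Vector_Spaces.linear scaleC scaleC U \<and> surj U \<and> (\<forall>x. norm (U x) = norm x)"

definition antiunitary :: "('a::complex_inner \<Rightarrow> 'a) \<Rightarrow> bool" where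
  "antiunitary U \<longleftrightarrow> (\<forall>x y. U (x + y) = U x + U y) \<and> (\<forall>c x. U (c *\<^sub>C x) = cnj c *\<^sub>C U x) \<and>
     surj U \<and> (\<forall>x. norm (U x) = norm x)"

text \<open>The next lemmas show that the inverse of a unitary or antiunitary operator is its adjoint.\<close>

lemma norm_add_sq_cinner:
  fixes x y :: "'a::complex_inner"
  shows "(norm (x + y))\<^sup>2 = (norm x)\<^sup>2 + (norm y)\<^sup>2 + 2 * Re (cinner x y)"
proof -
  have sq: "(norm z)\<^sup>2 = Re (cinner z z)" for z :: 'a
    by (simp add: norm_eq_sqrt_cinner cinner_ge_zero)
  have add_right: "cinner z (x + y) = cinner z x + cinner z y" for z
    by (metis cinner_add_left cinner_commute complex_cnj_add)
  have "Re (cinner y x) = Re (cinner x y)"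
    by (metis cinner_commute cnj.sel(1))
  then show ?thesis
    by (simp add: sq cinner_add_left add_right)
qed

lemma Re_cinner_isometry:
  fixes U :: "'a::complex_inner \<Rightarrow> 'a"
  assumes "\<And>x y. U (x + y) = U x + U y" "\<And>x. norm (U x) = norm x"
  shows "Re (cinner (U x) (U y)) = Re (cinner x y)"
proof -
  have "(norm (U x + U y))\<^sup>2 = (norm (x + y))\<^sup>2"
    by (metis assms)
  then show ?thesis
    by (simp add: norm_add_sq_cinner assms(2))
qed

lemma unitary_inv_adjoint:
  assumes "unitary U"
  shows "cinner (U x) y = cinner x (inv U y)"
proof -
  interpret Vector_Spaces.linear scaleC scaleC U
    using assms by (simp add: unitary_def)
  have iso: "norm (U z) = norm z" and surj: "surj U" for z
    using assms by (auto simp: unitary_def)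
  have R: "Re (cinner (U u) (U v)) = Re (cinner u v)" for u v
    by (rule Re_cinner_isometry) (auto simp: add iso)
  have "Im (cinner (U u) (U v)) = Im (cinner u v)" for u v
    using R[of "\<i> *\<^sub>C u" v] by (simp add: scale cinner_scaleC_left)
  with R have "cinner (U x) (U (inv U y)) = cinner x (inv U y)"
    by (simp add: complex_eq_iff)
  then show ?thesis
    by (simp add: surj_f_inv_f[OF surj])
qed

lemma antiunitary_inv_adjoint:
  assumes "antiunitary U"
  shows "cinner (U x) y = cnj (cinner x (inv U y))"
proof -
  have add: "U (u + v) = U u + U v" and conj: "U (c *\<^sub>C u) = cnj c *\<^sub>C U u"
    and iso: "norm (U u) = norm u" and surj: "surj U" for u v c
    using assms by (auto simp: antiunitary_def)
  have R: "Re (cinner (U u) (U v)) = Re (cinner u v)" for u v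
    by (rule Re_cinner_isometry) (auto simp: add iso)
  have "Im (cinner (U u) (U v)) = - Im (cinner u v)" for u v
    using R[of "\<i> *\<^sub>C u" v] unfolding conj cinner_scaleC_left by simp
  with R have "cinner (U x) (U (inv U y)) = cnj (cinner x (inv U y))"
    by (simp add: complex_eq_iff)
  then show ?thesis
    by (simp add: surj_f_inv_f[OF surj])
qed

end

theory Submission imports Defs begin

text \<open>A mixture automorphism, that is a bijection of the effects that preserves and reflects mixtures,
  sends segments onto segments; the work lies in showing that it is affine and then in recognising
  it. Affinity comes from the shape of the convex set of effects in dimension at least two: it has many
  two-dimensional sections that are parallelograms.

  Extreme effects are preserved, and they are exactly the projections
  (\<open>extreme_effectI_idem\<close>, \<open>extreme_effect_idem\<close>). Among them, \<open>0\<close> and the identity are singled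
  out by an incidence property. If segments \<open>[0, Z]\<close> and \<open>[W, V]\<close> cross whose ends are projections, with
  neither end of one equal to an end of the other, then \<open>W\<close> and \<open>V\<close> are orthogonal and \<open>Z = W + V\<close>, so \<open>W\<close> and \<open>V\<close> determine \<open>Z\<close>. A projection
  other than \<open>0\<close> and the identity lies on a circle of projections, a section of a translated Bloch
  ball, and there many chords from it cross a given chord (\<open>mixture_automorphism_0_or_id\<close>). After
  composition with \<open>A \<mapsto> I - A\<close>, if necessary, \<open>0\<close> and \<open>I\<close> are fixed.

  The plane spanned by \<open>I\<close> and a nonscalar effect meets the set of effects in a parallelogram. Its
  corners are \<open>0\<close>, \<open>A\<close>, \<open>I\<close>, \<open>I - A\<close> for an effect \<open>A\<close> of that plane whose numerical range has
  infimum \<open>0\<close> and supremum \<open>1\<close>. Such planes are carried to such planes, and corners, being the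
  extreme points of the section, to corners. A segment-preserving injection of a square into the plane that fixes the four corners is
  the identity (\<open>square_segment_map_id\<close>): four points in general position determine a projective
  map, and the real field has no nontrivial automorphism. Hence the map is affine on every such
  parallelogram (\<open>plane_point_image\<close>), in particular homogeneous, and a homogeneous
  segment-preserving map is affine (\<open>image_affine\<close>). It therefore preserves the order.

  Rank-one projections are the minimal nonzero projections, so they are preserved, and the diagonal
  value \<open>\<langle>A x, x\<rangle>\<close> can be read off from the order relations between \<open>A\<close> and combinations of the
  projection on \<open>x\<close> and \<open>I\<close> (\<open>qform_image\<close>). Applied to rank-one projections \<open>A\<close> this
  says that transition probabilities are preserved, and Wigner's theorem yields \<open>U\<close>; applied to
  arbitrary \<open>A\<close> it says that the image of \<open>A\<close> and \<open>U A U\<^sup>*\<close> have the same quadratic form.\<close>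

section \<open>The inner product\<close>

lemma cinner_add_right: "cinner x (y + z) = cinner x y + cinner x (z::'a::complex_inner)"
  by (metis cinner_add_left cinner_commute complex_cnj_add)

lemma cinner_scaleC_right: "cinner x (c *\<^sub>C y) = cnj c * cinner x (y::'a::complex_inner)"
  by (metis cinner_commute cinner_scaleC_left complex_cnj_mult)

lemma cinner_scaleR_left: "cinner (r *\<^sub>R x) y = of_real r * cinner x (y::'a::complex_inner)"
  by (simp add: scaleR_scaleC cinner_scaleC_left)

lemma cinner_scaleR_right: "cinner x (r *\<^sub>R y) = of_real r * cinner x (y::'a::complex_inner)"
  by (simp add: scaleR_scaleC cinner_scaleC_right)

lemma cinner_zero_left [simp]: "cinner 0 (y::'a::complex_inner) = 0"
  using cinner_scaleR_left[of 0 y y] by simp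

lemma cinner_zero_right [simp]: "cinner (y::'a::complex_inner) 0 = 0"
  using cinner_scaleR_right[of y 0 y] by simp

lemma cinner_minus_left: "cinner (- x) y = - cinner x (y::'a::complex_inner)"
  using cinner_scaleR_left[of "-1" x y] by simp

lemma cinner_minus_right: "cinner x (- y) = - cinner x (y::'a::complex_inner)"
  using cinner_scaleR_right[of x "-1" y] by simp

lemma cinner_diff_left: "cinner (x - y) z = cinner x z - cinner y (z::'a::complex_inner)"
  using cinner_add_left[of x "- y" z] by (simp add: cinner_minus_left)

lemma cinner_diff_right: "cinner x (y - z) = cinner x y - cinner x (z::'a::complex_inner)"
  using cinner_add_right[of x y "- z"] by (simp add: cinner_minus_right)

lemmas cinner_simps = cinner_add_left cinner_add_right cinner_diff_left cinner_diff_right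
  cinner_scaleC_left cinner_scaleC_right cinner_scaleR_left cinner_scaleR_right
  cinner_minus_left cinner_minus_right

lemma cinner_self: "cinner x x = of_real ((norm (x::'a::complex_inner))\<^sup>2)"
proof -
  have "Im (cinner x x) = 0"
    using arg_cong[OF cinner_commute[of x x], of Im] by simp
  then show ?thesis
    by (simp add: complex_eq_iff norm_eq_sqrt_cinner cinner_ge_zero)
qed

lemma Re_cinner_self: "Re (cinner x x) = (norm (x::'a::complex_inner))\<^sup>2"
  by (simp add: cinner_self)

lemma Re_cinner_commute: "Re (cinner x y) = Re (cinner y (x::'a::complex_inner))"
  by (metis cinner_commute cnj.sel(1))

lemma cmod_cinner_commute: "cmod (cinner x y) = cmod (cinner y (x::'a::complex_inner))"
  by (metis cinner_commute complex_mod_cnj)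

lemma cinner_orth_commute: "cinner x y = 0 \<longleftrightarrow> cinner y (x::'a::complex_inner) = 0"
  by (metis cinner_commute complex_cnj_zero)

lemma norm_scaleC: "norm (c *\<^sub>C x) = cmod c * norm (x::'a::complex_inner)"
proof -
  have "cinner (c *\<^sub>C x) (c *\<^sub>C x) = (c * cnj c) * cinner x x"
    by (simp add: cinner_simps)
  also have "\<dots> = of_real ((cmod c * norm x)\<^sup>2)"
    by (simp only: complex_norm_square[symmetric] cinner_self power_mult_distrib of_real_mult)
  finally have "of_real ((norm (c *\<^sub>C x))\<^sup>2) = (of_real ((cmod c * norm x)\<^sup>2) :: complex)"
    by (simp only: cinner_self)
  then have "(norm (c *\<^sub>C x))\<^sup>2 = (cmod c * norm x)\<^sup>2"
    by (metis of_real_eq_iff)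
  then show ?thesis
    by (simp add: power2_eq_iff_nonneg)
qed

lemma cinner_nondegenerate: "(\<And>y. cinner x y = cinner x' y) \<Longrightarrow> x = (x'::'a::complex_inner)"
  by (metis cinner_diff_left cinner_eq_zero_iff diff_self eq_iff_diff_eq_0)

lemma norm_diff_sq_cinner:
  "(norm (x - y))\<^sup>2 = (norm x)\<^sup>2 + (norm y)\<^sup>2 - 2 * Re (cinner x (y::'a::complex_inner))"
  using norm_add_sq_cinner[of x "- y"] by (simp add: cinner_minus_right)

text \<open>Multiplication by a phase makes inner products real; this is how the equality case of
  the Cauchy--Schwarz inequality and the phases in Wigner's theorem are handled.\<close>

lemma unit_phase: "\<exists>c. cmod c = 1 \<and> c * z = of_real (cmod z)"
proof (cases "z = 0")
  case False
  then have "cnj z / of_real (cmod z) * z = of_real (cmod z)"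
    by (simp add: complex_norm_square[symmetric] mult.commute power2_eq_square)
  moreover have "cmod (cnj z / of_real (cmod z)) = 1"
    using False by (simp add: norm_divide)
  ultimately show ?thesis by blast
qed (auto intro: exI[of _ 1])

lemma cinner_equality_case:
  fixes x y :: "'a::complex_inner"
  assumes "norm x = norm y" and "cmod (cinner x y) = (norm x)\<^sup>2"
  shows "\<exists>c. cmod c = 1 \<and> y = c *\<^sub>C x"
proof -
  obtain c where c: "cmod c = 1" "c * cinner x y = of_real (cmod (cinner x y))"
    using unit_phase by blast
  have "(norm (c *\<^sub>C x - y))\<^sup>2 = (norm x)\<^sup>2 + (norm x)\<^sup>2 - 2 * Re (c * cinner x y)"
    using assms(1) c(1) by (simp add: norm_diff_sq_cinner norm_scaleC cinner_simps)
  also have "\<dots> = 0"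
    by (simp add: c assms)
  finally show ?thesis
    using c(1) by (intro exI[of _ c]) simp
qed

lemma Cauchy_Schwarz: "cmod (cinner x y) \<le> norm x * norm (y::'a::complex_inner)"
proof (cases "y = 0")
  case False
  obtain c where c: "cmod c = 1" "c * cinner x y = of_real (cmod (cinner x y))"
    using unit_phase by blast
  have "0 \<le> (norm (norm y *\<^sub>R c *\<^sub>C x - norm x *\<^sub>R y))\<^sup>2" by simp
  also have "\<dots> = 2 * (norm y * norm x)\<^sup>2 - 2 * (norm y * (norm x * Re (c * cinner x y)))"
    using c(1) by (simp add: norm_diff_sq_cinner norm_scaleC cinner_simps power_mult_distrib algebra_simps)
  also have "\<dots> = 2 * (norm y * norm x) * (norm y * norm x - cmod (cinner x y))"
    by (simp add: c power2_eq_square algebra_simps)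
  finally have 1: "0 \<le> 2 * (norm y * norm x) * (norm y * norm x - cmod (cinner x y))" .
  show ?thesis
  proof (cases "x = 0")
    case False
    then have "0 < 2 * (norm y * norm x)" using \<open>y \<noteq> 0\<close> by simp
    then have "0 \<le> norm y * norm x - cmod (cinner x y)"
      using 1 mult_pos_neg by (meson not_le)
    then show ?thesis by (simp add: mult.commute)
  qed simp
qed simp

section \<open>Effects and their quadratic forms\<close>

definition qform :: "('a::complex_inner \<Rightarrow>\<^sub>L 'a) \<Rightarrow> 'a \<Rightarrow> real" where
  "qform A x = Re (cinner (A x) x)"

lemma qform_simps:
  "qform (A + B) x = qform A x + qform B x"
  "qform (A - B) x = qform A x - qform B x"
  "qform (r *\<^sub>R A) x = r * qform A x"
  "qform 0 x = 0"
  "qform id_blinfun x = (norm x)\<^sup>2"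
  by (simp_all add: qform_def blinfun.bilinear_simps cinner_simps Re_cinner_self)

lemma qform_scaleR: "qform A (r *\<^sub>R x) = r\<^sup>2 * qform A x"
  by (simp add: qform_def blinfun.bilinear_simps cinner_simps power2_eq_square)

text \<open>Symmetry forces complex linearity: \<open>A (c x)\<close> and \<open>c A x\<close> have the same inner product
  with every vector.\<close>

lemma self_adjoint_iff: "self_adjoint A \<longleftrightarrow> (\<forall>x y. cinner (A x) y = cinner x (A y))"
proof
  assume sym: "\<forall>x y. cinner (A x) y = cinner x (A y)"
  have "A (c *\<^sub>C x) = c *\<^sub>C A x" for c x
    by (rule cinner_nondegenerate) (simp add: sym cinner_simps)
  then have "Vector_Spaces.linear scaleC scaleC (blinfun_apply A)"
    by (auto simp: Vector_Spaces.linear_iff blinfun.add_right complex_vector.vector_space_axioms)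
  then show "self_adjoint A"
    using sym by (simp add: self_adjoint_def)
qed (simp add: self_adjoint_def)

lemma effects_iff:
  "A \<in> effects \<longleftrightarrow> (\<forall>x y. cinner (A x) y = cinner x (A y)) \<and> (\<forall>x. 0 \<le> qform A x \<and> qform A x \<le> (norm x)\<^sup>2)"
  by (auto simp: effects_def self_adjoint_iff op_le_def qform_def Re_cinner_self)

lemma effectsD:
  assumes "A \<in> effects"
  shows "cinner (A x) y = cinner x (A y)" "0 \<le> qform A x" "qform A x \<le> (norm x)\<^sup>2"
  using assms by (auto simp: effects_iff)

lemma effects_scaleC: "A \<in> effects \<Longrightarrow> A (c *\<^sub>C x) = c *\<^sub>C A x"
  by (rule cinner_nondegenerate) (simp add: effectsD cinner_simps)

lemma zero_effect [simp]: "0 \<in> effects"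
  and id_effect [simp]: "id_blinfun \<in> effects"
  by (simp_all add: effects_iff qform_simps)

lemma compl_effect [simp]: "id_blinfun - A \<in> effects \<longleftrightarrow> A \<in> effects"
  by (auto simp: effects_iff qform_simps blinfun.bilinear_simps cinner_simps)

lemma convex_effects:
  assumes "B \<in> effects" "C \<in> effects" "0 \<le> t" "t \<le> 1"
  shows "t *\<^sub>R B + (1 - t) *\<^sub>R C \<in> effects"
proof -
  have "t * qform B x + (1 - t) * qform C x \<le> (norm x)\<^sup>2" for x
    using assms effectsD(3) by (intro convex_bound_le) auto
  moreover have "0 \<le> t * qform B x + (1 - t) * qform C x" for x
    using assms effectsD(2)[of B x] effectsD(2)[of C x] by simp
  ultimately show ?thesis
    using assms(1,2) by (auto simp: effects_iff qform_simps blinfun.bilinear_simps cinner_simps)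
qed

lemma mixture_effects:
  "mixture A B C \<Longrightarrow> B \<in> effects \<Longrightarrow> C \<in> effects \<Longrightarrow> A \<in> effects"
  by (auto simp: mixture_def intro: convex_effects)

lemma scaleR_effect: "A \<in> effects \<Longrightarrow> 0 \<le> t \<Longrightarrow> t \<le> 1 \<Longrightarrow> t *\<^sub>R A \<in> effects"
  using convex_effects[of A 0 t] by simp

lemma qform_add:
  assumes "A \<in> effects"
  shows "qform A (x + y) = qform A x + qform A y + 2 * Re (cinner (A x) y)"
  using Re_cinner_commute[of "A x" y]
  by (simp add: qform_def blinfun.bilinear_simps cinner_simps effectsD(1)[OF assms, of y x])

lemma qform_diff:
  assumes "A \<in> effects"
  shows "qform A (x - y) = qform A x + qform A y - 2 * Re (cinner (A x) y)"
  using qform_add[OF assms, of x "- y"] qform_scaleR[of A "-1" y]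
  by (simp add: cinner_minus_right)

lemma qform_eqI:
  assumes "A \<in> effects" "B \<in> effects" "\<And>x. qform A x = qform B x"
  shows "A = B"
proof (rule blinfun_eqI)
  fix x
  have "Re (cinner (A x) y) = Re (cinner (B x) y)" for y
    using qform_add[OF assms(1), of x y] qform_add[OF assms(2), of x y] assms(3) by simp
  from this[of "A x - B x"] have "Re (cinner (A x - B x) (A x - B x)) = 0"
    by (simp add: cinner_diff_left)
  then show "A x = B x" by (simp add: Re_cinner_self)
qed

text \<open>This is \<open>A\<^sup>2 \<le> A\<close>. It makes \<open>A\<^sup>2\<close> an effect, and it
  turns a vanishing value of the quadratic form into a kernel vector.\<close>

lemma norm_effect_le:
  assumes "A \<in> effects"
  shows "(norm (A x))\<^sup>2 \<le> qform A x"
  \<comment> \<open>The form is nonnegative at \<open>x - A x\<close>, and its value at \<open>A x\<close> is at most the square of the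
      norm.\<close>
  using effectsD(2)[OF assms, of "x - A x"] effectsD(3)[OF assms, of "A x"]
  by (simp add: qform_diff[OF assms] Re_cinner_self)

lemma qform_eq_0D: "A \<in> effects \<Longrightarrow> qform A x = 0 \<Longrightarrow> A x = 0"
  using norm_effect_le[of A x] by simp

lemma qform_eq_normD:
  assumes "A \<in> effects" "qform A x = (norm x)\<^sup>2"
  shows "A x = x"
  using qform_eq_0D[of "id_blinfun - A" x] assms by (simp add: qform_simps blinfun.bilinear_simps)

section \<open>Extreme effects are the projections\<close>

definition extreme_effect :: "('a::complex_inner \<Rightarrow>\<^sub>L 'a) \<Rightarrow> bool" where
  "extreme_effect A \<longleftrightarrow> A \<in> effects \<and> (\<forall>B\<in>effects. \<forall>C\<in>effects. mixture A B C \<longrightarrow> A = B \<or> A = C)"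

text \<open>If \<open>A\<close> is a proper mixture of \<open>B\<close> and \<open>C\<close>, then the bounds \<open>0\<close> and \<open>1\<close> are attained by the
  form of \<open>A\<close> on its kernel and its range, so \<open>B\<close> has to attain them there as well and
  agrees with \<open>A\<close> on both.\<close>

lemma extreme_effectI_idem:
  assumes A: "A \<in> effects" and idem: "\<And>x. A (A x) = A x"
  shows "extreme_effect A"
  unfolding extreme_effect_def
proof (intro conjI ballI impI A)
  fix B C assume BC: "B \<in> effects" "C \<in> effects" and "mixture A B C"
  then obtain t where t: "0 \<le> t" "t \<le> 1" "A = t *\<^sub>R B + (1 - t) *\<^sub>R C"
    by (auto simp: mixture_def)
  show "A = B \<or> A = C"
  proof (cases "t = 0 \<or> t = 1")
    case False
    then have t': "0 < t" "t < 1" using t by auto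
    have q: "qform A x = t * qform B x + (1 - t) * qform C x" for x
      by (simp add: t(3) qform_simps)
    have ker: "B x = 0" if "A x = 0" for x
    proof -
      have "t * qform B x + (1 - t) * qform C x = 0"
        using q[of x] that by (simp add: qform_def)
      moreover have "0 \<le> (1 - t) * qform C x" "0 \<le> t * qform B x"
        using t' BC by (auto intro: mult_nonneg_nonneg effectsD(2))
      ultimately have "t * qform B x = 0" by linarith
      then show ?thesis using t' qform_eq_0D[OF BC(1)] by auto
    qed
    have ran: "B x = x" if "A x = x" for x
    proof -
      have "t * qform B x + (1 - t) * qform C x = (norm x)\<^sup>2"
        using q[of x] that by (simp add: qform_def Re_cinner_self)
      then have "t * ((norm x)\<^sup>2 - qform B x) + (1 - t) * ((norm x)\<^sup>2 - qform C x) = 0"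
        by (simp add: algebra_simps)
      moreover have "0 \<le> (1 - t) * ((norm x)\<^sup>2 - qform C x)" "0 \<le> t * ((norm x)\<^sup>2 - qform B x)"
        using t' effectsD(3)[OF BC(1), of x] effectsD(3)[OF BC(2), of x] by auto
      ultimately have "t * ((norm x)\<^sup>2 - qform B x) = 0" by linarith
      then show ?thesis using t' qform_eq_normD[OF BC(1)] by auto
    qed
    have "A x = B x" for x
      using ker[of "x - A x"] ran[of "A x"] idem by (simp add: blinfun.bilinear_simps)
    then show ?thesis by (simp add: blinfun_eqI)
  qed (use t in auto)
qed

text \<open>Every effect \<open>A\<close> is the midpoint of the effects \<open>A\<^sup>2\<close> and \<open>2 A - A\<^sup>2\<close>.\<close>

lemma extreme_effect_idem:
  assumes "extreme_effect A"
  shows "A (A x) = A x"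
proof -
  have A: "A \<in> effects" using assms by (simp add: extreme_effect_def)
  define S where "S = (A o\<^sub>L A)"
  have qS: "qform S x = (norm (A x))\<^sup>2" for x
    by (simp add: S_def qform_def effectsD(1)[OF A, of "A x"] Re_cinner_self)
  have sS: "cinner (S x) y = cinner x (S y)" for x y
    by (simp add: S_def effectsD(1)[OF A])
  have S: "S \<in> effects"
    using order_trans[OF norm_effect_le[OF A] effectsD(3)[OF A]] by (simp add: effects_iff sS qS)
  have "qform A x * 2 \<le> (norm x)\<^sup>2 + (norm (A x))\<^sup>2" for x
    using zero_le_power2[of "norm (x - A x)"] Re_cinner_commute[of "A x" x]
    by (simp add: norm_diff_sq_cinner qform_def)
  moreover have "0 \<le> 2 * qform A x - (norm (A x))\<^sup>2" for x
    using norm_effect_le[OF A, of x] effectsD(2)[OF A, of x] by linarith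
  ultimately have R: "2 *\<^sub>R A - S \<in> effects"
    by (auto simp: effects_iff qform_simps qS blinfun.bilinear_simps cinner_simps sS effectsD(1)[OF A] mult.commute)
       (smt (verit))
  have "mixture A S (2 *\<^sub>R A - S)"
    unfolding mixture_def by (rule bexI[of _ "1/2"]) (auto simp: algebra_simps simp flip: scaleR_add_left)
  then have "A = S \<or> A = 2 *\<^sub>R A - S"
    using assms S R by (auto simp: extreme_effect_def)
  then have "A = S"
    by (auto simp: scaleR_2)
  then show ?thesis
    by (metis S_def blinfun_apply_blinfun_compose)
qed

section \<open>Rank-one operators\<close>

lift_definition rank1 :: "'a::complex_inner \<Rightarrow> ('a \<Rightarrow>\<^sub>L 'a)" is "\<lambda>v x. cinner x v *\<^sub>C v"
proof (rule bounded_linear_intro)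
  fix v x y :: 'a and r :: real
  show "cinner (x + y) v *\<^sub>C v = cinner x v *\<^sub>C v + cinner y v *\<^sub>C v"
    by (simp add: cinner_simps scaleC_add_left)
  show "cinner (r *\<^sub>R x) v *\<^sub>C v = r *\<^sub>R cinner x v *\<^sub>C v"
    by (simp add: cinner_simps scaleR_scaleC scaleC_scaleC)
  have "cmod (cinner x v) * norm v \<le> (norm x * norm v) * norm v"
    by (intro mult_right_mono Cauchy_Schwarz) auto
  then show "norm (cinner x v *\<^sub>C v) \<le> norm x * (norm v * norm v)"
    by (simp add: norm_scaleC mult.assoc)
qed

lemma qform_rank1: "qform (rank1 v) x = (cmod (cinner x v))\<^sup>2"
proof -
  have "cinner x v * cinner v x = of_real ((cmod (cinner x v))\<^sup>2)"
    by (metis cinner_commute complex_norm_square)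
  then show ?thesis
    by (simp add: qform_def rank1.rep_eq cinner_simps)
qed

lemma rank1_symmetric: "cinner (rank1 v x) y = cinner x (rank1 v y)"
  using cinner_commute[of v y] by (simp add: rank1.rep_eq cinner_simps)

lemma rank1_effect:
  assumes "norm v = 1"
  shows "rank1 v \<in> effects"
proof -
  have "(cmod (cinner x v))\<^sup>2 \<le> (norm x)\<^sup>2" for x
    using Cauchy_Schwarz[of x v] assms by (intro power_mono) auto
  then show ?thesis
    by (simp add: effects_iff rank1_symmetric qform_rank1)
qed

lemma rank1_extreme:
  assumes "norm v = 1"
  shows "extreme_effect (rank1 v)"
  using assms by (intro extreme_effectI_idem rank1_effect) (simp_all add: rank1.rep_eq cinner_simps cinner_self)

lemma rank1_phase: "cmod c = 1 \<Longrightarrow> rank1 (c *\<^sub>C v) = rank1 v"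
  by (rule blinfun_eqI)
     (simp add: rank1.rep_eq cinner_simps scaleC_scaleC complex_norm_square[symmetric] mult.commute mult.left_commute)

section \<open>Segment-preserving maps of the square\<close>

text \<open>Density of the fractions and monotonicity; this is where the order of the
  real line, and not only its field structure, enters the rigidity of the square.\<close>

lemma mono_fixing_fractions_eq:
  fixes b :: "real \<Rightarrow> real"
  assumes mono: "\<And>x y. 0 < x \<Longrightarrow> x \<le> y \<Longrightarrow> y \<le> 1 \<Longrightarrow> b x \<le> b y"
    and frac: "\<And>m n::nat. 0 < m \<Longrightarrow> m \<le> n \<Longrightarrow> b (real m / real n) = real m / real n"
    and x: "0 < x" "x < 1"
  shows "b x = x"
proof -
  have rat: "b q = q" if "q \<in> \<rat>" "0 < q" "q \<le> 1" for q
  proof -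
    have "\<exists>m n::nat. n \<noteq> 0 \<and> \<bar>q\<bar> = real m / real n"
      by (rule Rats_abs_nat_div_natE[OF that(1)]) blast
    then obtain m n :: nat where mn: "n \<noteq> 0" "\<bar>q\<bar> = real m / real n"
      by blast
    then have "q = real m / real n" using that by simp
    moreover have "0 < m"
      using that mn by (cases "m = 0") auto
    moreover have "real m = q * real n"
      using mn \<open>q = _\<close> by simp
    then have "real m \<le> real n"
      using that by (simp add: mult_left_le_one_le)
    ultimately show ?thesis using frac by simp
  qed
  show ?thesis
  proof (rule ccontr)
    assume "b x \<noteq> x"
    then consider "b x < x" | "x < b x" by linarith
    then show False
    proof cases
      case 1
      then obtain q where q: "q \<in> \<rat>" "max 0 (b x) < q" "q < x"
        using Rats_dense_in_real[of "max 0 (b x)" x] x by auto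
      then show False using mono[of q x] rat[of q] x by auto
    next
      case 2
      then obtain q where q: "q \<in> \<rat>" "x < q" "q < min 1 (b x)"
        using Rats_dense_in_real[of x "min 1 (b x)"] x by auto
      then show False using mono[of x q] rat[of q] x by auto
    qed
  qed
qed

text \<open>Here \<open>b\<close> describes the restriction of a segment-preserving map to an edge of the unit
  square and \<open>g\<close> its restriction to the diagonal from the same corner. The two functional equations
  come from segments that cross the diagonal: from an edge to the adjacent edge at that corner, and to
  the opposite edge. The second makes \<open>b\<close> multiplicative. The first makes \<open>h u = 1 / b (1 / u)\<close> affine
  on the naturals, since \<open>h u + h v\<close> depends on \<open>u + v\<close> only. Both together leave the identity on
  the fractions.\<close>

lemma edge_function_identity:
  fixes b g :: "real \<Rightarrow> real"
  assumes b0: "b 0 = 0" and b1: "b 1 = 1"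
    and mono: "\<And>x y. 0 \<le> x \<Longrightarrow> x < y \<Longrightarrow> y \<le> 1 \<Longrightarrow> b x < b y"
    and har: "\<And>x y. 0 < x \<Longrightarrow> x \<le> 1 \<Longrightarrow> 0 < y \<Longrightarrow> y \<le> 1 \<Longrightarrow>
        g (x * y / (x + y)) * (b x + b y) = b x * b y"
    and quo: "\<And>x y. 0 < x \<Longrightarrow> x \<le> 1 \<Longrightarrow> 0 < y \<Longrightarrow> y \<le> 1 \<Longrightarrow>
        g (x / (x + y)) * (b x + b y) = b x"
    and x: "0 \<le> x" "x \<le> 1"
  shows "b x = x"
proof -
  have pos: "0 < b x" if "0 < x" "x \<le> 1" for x
    using mono[of 0 x] that b0 by simp
  have mult: "b (x * y) = b x * b y" if "0 < x" "x \<le> 1" "0 < y" "y \<le> 1" for x y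
  proof -
    have xy: "0 < x * y" "x * y \<le> 1" using that by (auto intro: mult_le_one)
    \<comment> \<open>The second functional equation at \<open>(x y, y)\<close> and at \<open>(x, 1)\<close> concerns the same point of the
        diagonal.\<close>
    have e: "x * y / (x * y + y) = x / (x + 1)"
    proof -
      have "x * y + y = (x + 1) * y" by (simp add: algebra_simps)
      then show ?thesis using that by simp
    qed
    have p: "0 < b x" "0 < b y" "0 < b (x * y)" using pos that xy by auto
    have "g (x / (x + 1)) * (b (x * y) + b y) = b (x * y)"
      using quo[OF xy that(3,4)] e by simp
    moreover have "g (x / (x + 1)) * (b x + 1) = b x"
      using quo[OF that(1,2), of 1] b1 by simp
    ultimately have "b (x * y) * (b x + 1) = b x * (b (x * y) + b y)"
      by (metis mult.assoc mult.commute)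
    then show ?thesis by (simp add: algebra_simps)
  qed
  define h where "h u = 1 / b (1 / u)" for u
  have hpos: "0 < h u" if "1 \<le> u" for u
    unfolding h_def using pos[of "1/u"] that by simp
  have hmult: "h (u * v) = h u * h v" if "1 \<le> u" "1 \<le> v" for u v
    unfolding h_def using mult[of "1/u" "1/v"] that by simp
  have hG: "(h u + h v) * g (1 / (u + v)) = 1" if "1 \<le> u" "1 \<le> v" for u v
  proof -
    have p: "0 < b (1 / u)" "0 < b (1 / v)" using pos that by auto
    have "1 / u * (1 / v) / (1 / u + 1 / v) = 1 / (u + v)"
      using that by (simp add: field_simps)
    then have "g (1 / (u + v)) * (b (1 / u) + b (1 / v)) = b (1 / u) * b (1 / v)"
      using har[of "1/u" "1/v"] that by simp
    then show ?thesis unfolding h_def using p by (simp add: field_simps)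
  qed
  have h1: "h 1 = 1" by (simp add: h_def b1)
  define c where "c = h 2 - 1"
  have step: "h (u + 1) = h u + c" if "1 \<le> u" for u
  proof -
    have "(h (u + 1) + h 1) * g (1 / (u + 2)) = (h u + h 2) * g (1 / (u + 2))"
      using hG[of "u + 1" 1] hG[of u 2] that by (simp add: add.assoc)
    moreover have "g (1 / (u + 2)) \<noteq> 0" using hG[of u 2] that by auto
    ultimately show ?thesis by (simp add: c_def h1)
  qed
  \<comment> \<open>Multiplicativity at \<open>4 = 2 * 2\<close> fixes the slope \<open>c\<close> of the affine function \<open>h\<close>.\<close>
  have "h 4 = h 2 * h 2" using hmult[of 2 2] by simp
  moreover have "h 2 = 1 + c" by (simp add: c_def)
  moreover have h3: "h 3 = 1 + 2 * c" using step[of 2] by (simp add: c_def)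
  moreover have "h 4 = 1 + 3 * c" using step[of 3] h3 by simp
  ultimately have "1 + 3 * c = (1 + c) * (1 + c)" by simp
  then have "c * c = c" by (simp add: algebra_simps)
  moreover have "c > 0" using mono[of "1/2" 1] pos[of "1/2"] by (simp add: c_def h_def b1)
  ultimately have c: "c = 1" by simp
  have hnat: "h (real n + 1) = real n + 1" for n
  proof (induction n)
    case (Suc n)
    then show ?case using step[of "real n + 1"] c by (simp add: add.commute)
  qed (simp add: h1)
  have bnat: "b (1 / real n) = 1 / real n" if "0 < n" for n
  proof -
    have "1 / b (1 / real n) = real n"
      using hnat[of "n - 1"] that unfolding h_def by (simp add: of_nat_diff)
    then show ?thesis by (metis inverse_eq_divide inverse_inverse_eq)
  qed
  have frac: "b (real m / real n) = real m / real n" if "0 < m" "m \<le> n" for m n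
  proof -
    have "b (real m / real n * (1 / real m)) = b (real m / real n) * b (1 / real m)"
      using that by (intro mult) auto
    moreover have "real m / real n * (1 / real m) = 1 / real n"
      using that by simp
    ultimately have "1 / real n = b (real m / real n) / real m"
      using that bnat[of m] bnat[of n] by simp
    then have "real m * (1 / real n) = real m * (b (real m / real n) / real m)"
      by (rule arg_cong)
    then show ?thesis using that by simp
  qed
  have "b x = x" if "x \<noteq> 0" "x \<noteq> 1"
  proof (rule mono_fixing_fractions_eq[of b])
    show "b u \<le> b v" if "0 < u" "u \<le> v" "v \<le> 1" for u v
      using mono[of u v] that by (cases "u = v") auto
  qed (use x frac that in auto)
  then show ?thesis using b0 b1 by blast
qed

definition unit_square :: "(real \<times> real) set" where
  "unit_square = {0..1} \<times> {0..1}"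

lemma mixture_pair:
  "mixture (x, y) (x1, y1) (x2, y2) \<longleftrightarrow>
     (\<exists>t\<in>{0..1::real}. x = t * x1 + (1 - t) * x2 \<and> y = t * y1 + (1 - t) * y2)"
  by (simp add: mixture_def)

text \<open>The centre is fixed as the crossing of the diagonals, which makes the restrictions to
  opposite edges determine each other. The crossings of other segments with one diagonal give the
  functional equations of \<open>edge_function_identity\<close>, so the four edges are fixed pointwise; an
  arbitrary point is then the crossing of a horizontal and a vertical segment.\<close>

lemma square_segment_map_id:
  fixes F :: "real \<times> real \<Rightarrow> real \<times> real"
  assumes seg: "\<And>u v w. u \<in> unit_square \<Longrightarrow> v \<in> unit_square \<Longrightarrow> w \<in> unit_square \<Longrightarrow>
      mixture u v w \<Longrightarrow> mixture (F u) (F v) (F w)"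
    and inj: "inj_on F unit_square"
    and corners: "F (0, 0) = (0, 0)" "F (1, 0) = (1, 0)" "F (0, 1) = (0, 1)" "F (1, 1) = (1, 1)"
    and p: "p \<in> unit_square"
  shows "F p = p"
proof -
  have sq: "(x, y) \<in> unit_square \<longleftrightarrow> 0 \<le> x \<and> x \<le> 1 \<and> 0 \<le> y \<and> y \<le> 1" for x y
    by (auto simp: unit_square_def)
  define b where "b x = fst (F (x, 0))" for x
  define l where "l y = snd (F (0, y))" for y
  define t where "t x = fst (F (x, 1))" for x
  define r where "r y = snd (F (1, y))" for y
  define g where "g d = fst (F (d, d))" for d
  have Fb: "F (x, 0) = (b x, 0)" and Fl: "F (0, x) = (0, l x)"
    and Ft: "F (x, 1) = (t x, 1)" and Fr: "F (1, x) = (1, r x)"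
    and Fg: "F (x, x) = (g x, g x)"
    and Fa: "fst (F (x, 1 - x)) + snd (F (x, 1 - x)) = 1" if "0 \<le> x" "x \<le> 1" for x
  proof -
    have *: "mixture (F u) (F v) (F w)"
      if "mixture u v w" "u \<in> unit_square" "v \<in> unit_square" "w \<in> unit_square" for u v w
      using seg that by blast
    have "mixture (x, 0::real) (1, 0) (0, 0)" "mixture (0::real, x) (0, 1) (0, 0)"
      "mixture (x, 1::real) (1, 1) (0, 1)" "mixture (1::real, x) (1, 1) (1, 0)"
      "mixture (x, x) (1, 1) (0, 0)" "mixture (x, 1 - x) (1, 0) (0, 1)"
      using that unfolding mixture_pair by (auto intro!: bexI[of _ x])
    from this[THEN *] show "F (x, 0) = (b x, 0)" "F (0, x) = (0, l x)"
        "F (x, 1) = (t x, 1)" "F (1, x) = (1, r x)" "F (x, x) = (g x, g x)"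
        "fst (F (x, 1 - x)) + snd (F (x, 1 - x)) = 1"
      using that by (auto simp: sq corners mixture_def b_def l_def t_def r_def g_def)
  qed
  have b0: "b 0 = 0" and b1: "b 1 = 1" and l0: "l 0 = 0" and l1: "l 1 = 1"
    by (simp_all add: b_def l_def corners)
  have bmono: "b x < b y" if "0 \<le> x" "x < y" "y \<le> 1" for x y
  proof -
    have xy: "0 \<le> x" "x \<le> 1" "0 \<le> y" "y \<le> 1" using that by auto
    have "mixture (x, 0::real) (y, 0) (0, 0)"
      using that by (auto simp: mixture_pair intro!: bexI[of _ "x / y"])
    then have "mixture (F (x, 0)) (F (y, 0)) (F (0, 0))"
      using that by (intro seg) (auto simp: sq)
    then obtain s where s: "0 \<le> s" "s \<le> 1" "b x = s * b y"
      using xy by (auto simp: Fb corners mixture_def)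
    have "mixture (F (y, 0)) (F (1, 0)) (F (0, 0))"
      using that by (intro seg) (auto simp: sq mixture_pair)
    then have "0 \<le> b y"
      using xy by (auto simp: Fb corners mixture_def)
    then have "b x \<le> b y"
      using s by (simp add: mult_left_le_one_le)
    moreover have "F (x, 0) \<noteq> F (y, 0)"
      using inj_onD[OF inj, of "(x, 0)" "(y, 0)"] that xy by (auto simp: sq)
    ultimately show ?thesis using that xy by (simp add: Fb)
  qed
  have "(1/2, 1/2) = F (1/2, 1/2)"
    using Fg[of "1/2"] Fa[of "1/2"] by auto
  then have centre: "g (1/2) = 1/2"
    by (simp add: Fg)
  have bt: "t (1 - x) = 1 - b x" if x: "0 \<le> x" "x \<le> 1" for x
  proof -
    have "mixture (F (1/2, 1/2)) (F (x, 0)) (F (1 - x, 1))"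
      using that by (intro seg) (auto simp: sq mixture_pair field_simps intro!: bexI[of _ "1/2"])
    then obtain s where s: "g (1/2) = s * b x + (1 - s) * t (1 - x)" "g (1/2) = 1 - s"
      using x by (auto simp: Fb Ft Fg mixture_def)
    then have "s = 1/2" using centre by simp
    with s(1) show ?thesis using centre by (simp add: field_simps)
  qed
  have lr: "r (1 - x) = 1 - l x" if x: "0 \<le> x" "x \<le> 1" for x
  proof -
    have "mixture (F (1/2, 1/2)) (F (0, x)) (F (1, 1 - x))"
      using that by (intro seg) (auto simp: sq mixture_pair field_simps intro!: bexI[of _ "1/2"])
    then obtain s where s: "g (1/2) = 1 - s" "g (1/2) = s * l x + (1 - s) * r (1 - x)"
      using x by (auto simp: Fl Fr Fg mixture_def)
    then have "s = 1/2" using centre by simp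
    with s(2) show ?thesis using centre by (simp add: field_simps)
  qed
  \<comment> \<open>The crossing of the diagonal with the segment from \<open>(x, 0)\<close> to \<open>(0, y)\<close>.\<close>
  have bl: "g (x * y / (x + y)) * (b x + l y) = b x * l y" if "0 < x" "x \<le> 1" "0 < y" "y \<le> 1" for x y
  proof -
    let ?d = "x * y / (x + y)"
    have xy: "0 \<le> x" "x \<le> 1" "0 \<le> y" "y \<le> 1" using that by auto
    have "x * y \<le> x" using that by (simp add: mult_left_le)
    then have "x * y \<le> x + y" using that by linarith
    then have d: "0 \<le> ?d" "?d \<le> 1" using that by auto
    have w: "1 - y / (x + y) = x / (x + y)" using that by (simp add: field_simps)
    have "mixture (F (?d, ?d)) (F (x, 0)) (F (0, y))"
      using that d w by (intro seg) (auto simp: sq mixture_pair mult.commute intro!: bexI[of _ "y / (x + y)"])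
    then obtain s where s: "g ?d = s * b x" "g ?d = (1 - s) * l y"
      using xy d by (auto simp: Fb Fl Fg mixture_def)
    have "g ?d * l y + g ?d * b x = s * b x * l y + (1 - s) * l y * b x"
      using s by simp
    then show ?thesis by (simp add: algebra_simps)
  qed
  \<comment> \<open>The crossing of the diagonal with the segment from \<open>(x, 0)\<close> to \<open>(1 - y, 1)\<close>.\<close>
  have quo: "g (x / (x + y)) * (b x + b y) = b x" if "0 < x" "x \<le> 1" "0 < y" "y \<le> 1" for x y
  proof -
    let ?d = "x / (x + y)"
    have d: "0 \<le> ?d" "?d \<le> 1" using that by (auto simp: field_simps)
    have xy: "0 \<le> x" "x \<le> 1" "0 \<le> y" "y \<le> 1" using that by auto
    have w: "1 - y / (x + y) = x / (x + y)" using that by (simp add: field_simps)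
    have w': "x / (x + y) = x * y / (x + y) + x * (1 - y) / (x + y)"
      by (simp add: right_diff_distrib flip: add_divide_distrib)
    have "mixture (F (?d, ?d)) (F (x, 0)) (F (1 - y, 1))"
      using that d w w'[symmetric] by (intro seg) (auto simp: sq mixture_pair mult.commute intro!: bexI[of _ "y / (x + y)"])
    then obtain s where s: "g ?d = s * b x + (1 - s) * (1 - b y)" "g ?d = 1 - s"
      using xy d by (auto simp: Fb Ft bt Fg mixture_def)
    then have "s = 1 - g ?d" by simp
    with s(1) show ?thesis by (simp add: algebra_simps)
  qed
  have l_eq: "l x = b x" if "0 \<le> x" "x \<le> 1" for x
  proof (cases "x = 0")
    case False
    then have "0 < x" using that by simp
    have bx: "0 < b x" using bmono[of 0 x] that False b0 by simp
    have 1: "g (x / (1 + x)) * (1 + l x) = l x"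
      using bl[of 1 x] \<open>0 < x\<close> that by (simp add: b1)
    have 2: "g (x / (1 + x)) * (b x + 1) = b x"
      using bl[of x 1] \<open>0 < x\<close> that by (simp add: l1 add.commute)
    have "l x * (b x + 1) = b x * (1 + l x)"
      using 1 2 by (metis mult.assoc mult.commute)
    then show ?thesis by (simp add: algebra_simps)
  qed (simp add: b0 l0)
  have b_id: "b x = x" if "0 \<le> x" "x \<le> 1" for x
  proof (rule edge_function_identity[of b g])
    show "g (x * y / (x + y)) * (b x + b y) = b x * b y" if "0 < x" "x \<le> 1" "0 < y" "y \<le> 1" for x y
      using bl[OF that] l_eq[of y] that by simp
  qed (use b0 b1 bmono quo that in auto)
  obtain x y where xy: "p = (x, y)" "0 \<le> x" "x \<le> 1" "0 \<le> y" "y \<le> 1"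
    using p by (cases p) (auto simp: sq)
  have "mixture (F (x, y)) (F (x, 0)) (F (x, 1))"
    using xy by (intro seg) (auto simp: sq mixture_pair algebra_simps intro!: bexI[of _ "1 - y"])
  then have "fst (F (x, y)) = x"
    using xy bt[of "1 - x"] by (auto simp: Fb Ft b_id mixture_def algebra_simps)
  moreover have "mixture (F (x, y)) (F (0, y)) (F (1, y))"
    using xy by (intro seg) (auto simp: sq mixture_pair algebra_simps intro!: bexI[of _ "1 - x"])
  then have "snd (F (x, y)) = y"
    using xy lr[of "1 - y"] by (auto simp: Fl Fr l_eq b_id mixture_def algebra_simps)
  ultimately show ?thesis
    unfolding xy(1) by (intro prod_eqI) simp_all
qed

section \<open>Mixture automorphisms\<close>

definition mixture_automorphism :: "(('a::complex_inner \<Rightarrow>\<^sub>L 'a) \<Rightarrow> ('a \<Rightarrow>\<^sub>L 'a)) \<Rightarrow> bool" where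
  "mixture_automorphism \<phi> \<longleftrightarrow> bij_betw \<phi> effects effects \<and>
     (\<forall>A\<in>effects. \<forall>B\<in>effects. \<forall>C\<in>effects. mixture A B C \<longleftrightarrow> mixture (\<phi> A) (\<phi> B) (\<phi> C))"

lemma mixture_automorphism_effect:
  "mixture_automorphism \<phi> \<Longrightarrow> A \<in> effects \<Longrightarrow> \<phi> A \<in> effects"
  by (auto simp: mixture_automorphism_def bij_betw_def)

lemma mixture_automorphism_eq_iff:
  "mixture_automorphism \<phi> \<Longrightarrow> A \<in> effects \<Longrightarrow> B \<in> effects \<Longrightarrow> \<phi> A = \<phi> B \<longleftrightarrow> A = B"
  by (auto simp: mixture_automorphism_def bij_betw_def inj_on_def)

lemma mixture_automorphism_surj:
  assumes "mixture_automorphism \<phi>" "B \<in> effects"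
  obtains A where "A \<in> effects" "\<phi> A = B"
proof -
  have "B \<in> \<phi> ` effects"
    using assms by (simp add: mixture_automorphism_def bij_betw_def)
  then show ?thesis using that by blast
qed

lemma mixture_automorphism_mixture:
  "mixture_automorphism \<phi> \<Longrightarrow> A \<in> effects \<Longrightarrow> B \<in> effects \<Longrightarrow> C \<in> effects \<Longrightarrow>
     mixture (\<phi> A) (\<phi> B) (\<phi> C) \<longleftrightarrow> mixture A B C"
  by (simp add: mixture_automorphism_def)

lemma mixture_automorphism_inv:
  assumes "mixture_automorphism \<phi>"
  shows "mixture_automorphism (inv_into effects \<phi>)"
proof -
  have bij: "bij_betw \<phi> effects effects" using assms by (simp add: mixture_automorphism_def)
  have "mixture A B C \<longleftrightarrow> mixture (inv_into effects \<phi> A) (inv_into effects \<phi> B) (inv_into effects \<phi> C)"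
    if "A \<in> effects" "B \<in> effects" "C \<in> effects" for A B C
    using mixture_automorphism_mixture[OF assms, of "inv_into effects \<phi> A" "inv_into effects \<phi> B" "inv_into effects \<phi> C"]
      that bij by (simp add: bij_betw_inv_into_right bij_betw_apply[OF bij_betw_inv_into[OF bij]])
  then show ?thesis
    using bij_betw_inv_into[OF bij] by (simp add: mixture_automorphism_def)
qed

lemma mixture_automorphism_inv_apply:
  "mixture_automorphism \<phi> \<Longrightarrow> A \<in> effects \<Longrightarrow> inv_into effects \<phi> (\<phi> A) = A"
  "mixture_automorphism \<phi> \<Longrightarrow> A \<in> effects \<Longrightarrow> \<phi> (inv_into effects \<phi> A) = A"
  by (auto simp: mixture_automorphism_def bij_betw_inv_into_left bij_betw_inv_into_right)

lemma mixture_compl: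
  "mixture (id_blinfun - A) (id_blinfun - B) (id_blinfun - C) \<longleftrightarrow> mixture A B C"
proof -
  have "id_blinfun - A = t *\<^sub>R (id_blinfun - B) + (1 - t) *\<^sub>R (id_blinfun - C) \<longleftrightarrow>
      A = t *\<^sub>R B + (1 - t) *\<^sub>R C" for t
  proof -
    have "t *\<^sub>R (id_blinfun - B) + (1 - t) *\<^sub>R (id_blinfun - C) = id_blinfun - (t *\<^sub>R B + (1 - t) *\<^sub>R C)"
      by (simp add: algebra_simps)
    moreover have "id_blinfun - A = id_blinfun - Y \<longleftrightarrow> A = Y" for Y
      using right_minus_eq[of "id_blinfun - A" "id_blinfun - Y"] right_minus_eq[of Y A] by auto
    ultimately show ?thesis by (simp only:)
  qed
  then show ?thesis by (simp add: mixture_def)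
qed

lemma mixture_automorphism_compl:
  assumes "mixture_automorphism \<phi>"
  shows "mixture_automorphism (\<lambda>A. id_blinfun - \<phi> A)"
proof -
  have "bij_betw (\<lambda>A. id_blinfun - A) effects effects"
    by (rule bij_betwI[where g = "\<lambda>A. id_blinfun - A"]) auto
  then have "bij_betw ((\<lambda>A. id_blinfun - A) \<circ> \<phi>) effects effects"
    using assms by (intro bij_betw_trans[of \<phi> _ effects]) (simp_all add: mixture_automorphism_def)
  then show ?thesis
    using assms by (simp add: mixture_automorphism_def mixture_compl o_def)
qed

lemma extreme_effect_image:
  assumes \<phi>: "mixture_automorphism \<phi>" and A: "extreme_effect A"
  shows "extreme_effect (\<phi> A)"
proof -
  have "\<phi> A = B \<or> \<phi> A = C" if BC: "B \<in> effects" "C \<in> effects" "mixture (\<phi> A) B C" for B C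
  proof -
    obtain B' where "B' \<in> effects" "\<phi> B' = B" using mixture_automorphism_surj[OF \<phi> BC(1)] .
    moreover obtain C' where "C' \<in> effects" "\<phi> C' = C" using mixture_automorphism_surj[OF \<phi> BC(2)] .
    ultimately show ?thesis
      using BC(3) A mixture_automorphism_mixture[OF \<phi>, of A B' C'] by (auto simp: extreme_effect_def)
  qed
  then show ?thesis
    using A mixture_automorphism_effect[OF \<phi>, of A] by (simp add: extreme_effect_def)
qed

section \<open>The zero and identity operators among the extreme effects\<close>

definition crossing where
  "crossing A B C D \<longleftrightarrow> (\<exists>X. mixture X A B \<and> mixture X C D)"

text \<open>A property of extreme effects that is phrased in terms of mixtures alone, so that mixture
  automorphisms preserve it. It holds for a projection unless that projection is \<open>0\<close> or the
  identity.\<close>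

definition doubly_crossed :: "('a::complex_inner \<Rightarrow>\<^sub>L 'a) \<Rightarrow> bool" where
  "doubly_crossed P \<longleftrightarrow> (\<exists>Z Z' W V.
     extreme_effect Z \<and> extreme_effect Z' \<and> extreme_effect W \<and> extreme_effect V \<and>
     Z \<noteq> Z' \<and> P \<noteq> W \<and> P \<noteq> V \<and> Z \<noteq> W \<and> Z \<noteq> V \<and> Z' \<noteq> W \<and> Z' \<noteq> V \<and>
     crossing P Z W V \<and> crossing P Z' W V)"

lemma crossing_image:
  assumes \<phi>: "mixture_automorphism \<phi>" and E: "A \<in> effects" "B \<in> effects" "C \<in> effects" "D \<in> effects"
    and "crossing A B C D"
  shows "crossing (\<phi> A) (\<phi> B) (\<phi> C) (\<phi> D)"
  using assms mixture_effects[of _ A B] mixture_automorphism_mixture[OF \<phi>]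
  unfolding crossing_def by blast

lemma doubly_crossed_image:
  assumes \<phi>: "mixture_automorphism \<phi>" and P: "extreme_effect P" and "doubly_crossed P"
  shows "doubly_crossed (\<phi> P)"
proof -
  obtain Z Z' W V where *: "extreme_effect Z" "extreme_effect Z'" "extreme_effect W" "extreme_effect V"
    "Z \<noteq> Z'" "P \<noteq> W" "P \<noteq> V" "Z \<noteq> W" "Z \<noteq> V" "Z' \<noteq> W" "Z' \<noteq> V"
    "crossing P Z W V" "crossing P Z' W V"
    using assms(3) unfolding doubly_crossed_def by blast
  have E: "P \<in> effects" "Z \<in> effects" "Z' \<in> effects" "W \<in> effects" "V \<in> effects"
    using P *(1-4) by (simp_all add: extreme_effect_def)
  note eq = mixture_automorphism_eq_iff[OF \<phi>]
  show ?thesis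
    unfolding doubly_crossed_def
  proof (intro exI conjI)
    show "crossing (\<phi> P) (\<phi> Z) (\<phi> W) (\<phi> V)"
      by (rule crossing_image[OF \<phi> E(1,2,4,5) *(12)])
    show "crossing (\<phi> P) (\<phi> Z') (\<phi> W) (\<phi> V)"
      by (rule crossing_image[OF \<phi> E(1,3,4,5) *(13)])
  qed (simp_all add: eq E * extreme_effect_image[OF \<phi>])
qed

text \<open>The kernel of \<open>Z\<close> is contained in that of \<open>W\<close>, so \<open>Z\<close> fixes every \<open>x\<close> in the range of \<open>W\<close>. For
  such \<open>x\<close> the combination shows that \<open>x\<close> is an eigenvector of \<open>V\<close>, and the eigenvalue is \<open>0\<close> or
  \<open>1\<close>; the second case is \<open>t + u = s\<close>.\<close>

lemma projection_combination_coefficient: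
  assumes ext: "extreme_effect Z" "extreme_effect W" "extreme_effect V" and "W \<noteq> 0"
    and comb: "s *\<^sub>R Z = t *\<^sub>R W + u *\<^sub>R V" and pos: "0 < t" "0 < u" and ne: "t + u \<noteq> s"
  shows "t = s"
proof -
  have E: "Z \<in> effects" "W \<in> effects" "V \<in> effects" using ext by (auto simp: extreme_effect_def)
  obtain y where "W y \<noteq> 0" using \<open>W \<noteq> 0\<close> by (metis blinfun_eqI zero_blinfun.rep_eq)
  define x where "x = W y"
  have x: "x \<noteq> 0" "W x = x" using \<open>W y \<noteq> 0\<close> extreme_effect_idem[OF ext(2)] by (auto simp: x_def)
  have comb': "s *\<^sub>R Z z = t *\<^sub>R W z + u *\<^sub>R V z" for z
    using arg_cong[OF comb, of "\<lambda>A. blinfun_apply A z"] by (simp add: blinfun.bilinear_simps)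
  have ker: "W z = 0" if "Z z = 0" for z
  proof -
    have "t * qform W z + u * qform V z = s * qform Z z"
      using arg_cong[OF comb, of "\<lambda>A. qform A z"] by (simp add: qform_simps)
    also have "\<dots> = 0" using that by (simp add: qform_def)
    finally have "t * qform W z + u * qform V z = 0" .
    moreover have "0 \<le> t * qform W z" "0 \<le> u * qform V z"
      using pos E by (simp_all add: effectsD(2))
    ultimately have "t * qform W z = 0" by linarith
    then show ?thesis using pos qform_eq_0D[OF E(2)] by simp
  qed
  have WZ: "W (Z z) = W z" for z
    using ker[of "z - Z z"] extreme_effect_idem[OF ext(1)] by (simp add: blinfun.bilinear_simps)
  have "Z x = x"
  proof (rule cinner_nondegenerate)
    fix z
    have "cinner (Z x) z = cinner (W x) (Z z)" by (simp only: x effectsD(1)[OF E(1)])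
    also have "\<dots> = cinner x (W (Z z))" by (rule effectsD(1)[OF E(2)])
    also have "\<dots> = cinner (W x) z" by (simp only: WZ effectsD(1)[OF E(2)])
    also have "\<dots> = cinner x z" by (simp only: x)
    finally show "cinner (Z x) z = cinner x z" .
  qed
  then have V: "u *\<^sub>R V x = (s - t) *\<^sub>R x"
    using comb'[of x] x by (simp add: algebra_simps)
  have "u *\<^sub>R V x = (s - t) *\<^sub>R V x"
    using arg_cong[OF V, of "blinfun_apply V"]
    by (simp add: blinfun.scaleR_right extreme_effect_idem[OF ext(3)])
  then have "u *\<^sub>R (s - t) *\<^sub>R x = (s - t) *\<^sub>R (s - t) *\<^sub>R x"
    using V by (metis scaleR_left_commute)
  then have "(u * (s - t)) *\<^sub>R x = ((s - t) * (s - t)) *\<^sub>R x"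
    by simp
  then have "u * (s - t) = (s - t) * (s - t)" using x(1) by (simp only: scaleR_cancel_right) simp
  then show ?thesis using ne by simp
qed

text \<open>A projection \<open>Y\<close> whose segment from \<open>0\<close> crosses \<open>[W, V]\<close> is a positive combination of \<open>W\<close> and
  \<open>V\<close>. The coefficients are equal to \<open>1\<close>, so \<open>Y\<close> is \<open>W + V\<close> and there cannot be two such
  projections.\<close>

lemma not_doubly_crossed_0: "\<not> doubly_crossed (0 :: 'a::complex_inner \<Rightarrow>\<^sub>L 'a)"
proof
  assume "doubly_crossed (0 :: 'a \<Rightarrow>\<^sub>L 'a)"
  then obtain Z Z' W V :: "'a \<Rightarrow>\<^sub>L 'a" where *: "extreme_effect Z" "extreme_effect Z'"
    "extreme_effect W" "extreme_effect V" "Z \<noteq> Z'" "W \<noteq> 0" "V \<noteq> 0"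
    "Z \<notin> {W, V}" "Z' \<notin> {W, V}" "crossing 0 Z W V" "crossing 0 Z' W V"
    unfolding doubly_crossed_def by (metis empty_iff insert_iff)
  have E: "W \<in> effects" "V \<in> effects" using * by (auto simp: extreme_effect_def)
  have "Y = W + V" if Y: "extreme_effect Y" "Y \<notin> {W, V}" "crossing 0 Y W V" for Y
  proof -
    obtain s t where st: "0 \<le> s" "s \<le> 1" "0 \<le> t" "t \<le> 1" "(1 - s) *\<^sub>R Y = t *\<^sub>R W + (1 - t) *\<^sub>R V"
      using Y(3) by (auto simp: crossing_def mixture_def)
    have idem: "R (R x) = R x" if "R \<in> {Y, W, V}" for R x
      using that * Y extreme_effect_idem by auto
    have Y_ne: "\<not> mixture Y W V"
      using Y E by (auto simp: extreme_effect_def)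
    have "s \<noteq> 1"
    proof
      assume "s = 1"
      then have "mixture 0 W V" using st by (auto simp: mixture_def)
      moreover have "extreme_effect (0 :: 'a \<Rightarrow>\<^sub>L 'a)" by (rule extreme_effectI_idem) auto
      ultimately show False using E * by (auto simp: extreme_effect_def)
    qed
    \<comment> \<open>Proportional nonzero projections are equal.\<close>
    have nomult: False if "(1 - s) *\<^sub>R Y = R" "R \<noteq> 0" "R \<in> {W, V}" for R
    proof -
      obtain x where "R x \<noteq> 0" using \<open>R \<noteq> 0\<close> by (metis blinfun_eqI zero_blinfun.rep_eq)
      then have "Y x \<noteq> 0" by (auto simp: that(1)[symmetric] blinfun.bilinear_simps)
      moreover have "((1 - s) * (1 - s)) *\<^sub>R Y x = (1 - s) *\<^sub>R Y x"
        using idem[of R x] idem[of Y x] that(3) by (simp add: that(1)[symmetric] blinfun.bilinear_simps)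
      ultimately have "(1 - s) * (1 - s) = 1 - s" by (simp only: scaleR_cancel_right) simp
      then have "s = 0" using \<open>s \<noteq> 1\<close> by simp
      then show False using that Y(2) by simp
    qed
    have "t \<noteq> 0" "t \<noteq> 1" using nomult[of W] nomult[of V] st(5) * by auto
    then have t: "0 < t" "0 < 1 - t" using st by auto
    have "s \<noteq> 0" using Y_ne st by (auto simp: mixture_def)
    then have "t = 1 - s" "1 - t = 1 - s"
      using projection_combination_coefficient[OF Y(1) *(3) *(4) *(6) st(5) t]
        projection_combination_coefficient[OF Y(1) *(4) *(3) *(7) _ t(2,1), of "1 - s"] st(5)
      by (auto simp: add.commute)
    then have "(1 - s) *\<^sub>R Y = (1 - s) *\<^sub>R (W + V)"
      using st(5) by (simp add: scaleR_add_right)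
    then show ?thesis using \<open>s \<noteq> 1\<close> by simp
  qed
  from this[of Z] this[of Z'] * show False by simp
qed

lemma not_doubly_crossed_id: "\<not> doubly_crossed (id_blinfun :: 'a::complex_inner \<Rightarrow>\<^sub>L 'a)"
proof
  assume "doubly_crossed (id_blinfun :: 'a \<Rightarrow>\<^sub>L 'a)"
  moreover have "mixture_automorphism (\<lambda>A. id_blinfun - (A :: 'a \<Rightarrow>\<^sub>L 'a))"
    using mixture_automorphism_compl[of "\<lambda>A. A"] by (simp add: mixture_automorphism_def bij_betw_def)
  moreover have "extreme_effect (id_blinfun :: 'a \<Rightarrow>\<^sub>L 'a)" by (rule extreme_effectI_idem) auto
  ultimately show False
    using doubly_crossed_image not_doubly_crossed_0 by fastforce
qed

text \<open>Take unit vectors \<open>e\<close> in the range and \<open>f\<close> in the kernel of \<open>P\<close>. Replacing the line of \<open>e\<close> by the line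
  of \<open>a e + b f\<close>, where \<open>a\<^sup>2 + b\<^sup>2 = 1\<close>, gives projections \<open>R a b\<close> on a circle through \<open>P = R 1 0\<close>. The
  coordinate \<open>b\<^sup>2\<close> is affine on the plane of the circle, so a chord from \<open>P\<close> to \<open>R a b\<close> with \<open>b\<^sup>2 \<ge> d\<^sup>2\<close>
  crosses the chord between \<open>R c d\<close> and \<open>R c (-d)\<close>. Pythagorean triples give rational examples.\<close>

lemma projection_doubly_crossed:
  fixes P :: "'a::complex_inner \<Rightarrow>\<^sub>L 'a"
  assumes P: "extreme_effect P" and ne: "P \<noteq> 0" "P \<noteq> id_blinfun"
  shows "doubly_crossed P"
proof -
  have PE: "P \<in> effects" using P by (simp add: extreme_effect_def)
  note idem = extreme_effect_idem[OF P]
  obtain x where "P x \<noteq> 0" using ne(1) by (metis blinfun_eqI zero_blinfun.rep_eq)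
  have "\<exists>y. y - P y \<noteq> 0"
  proof (rule ccontr)
    assume "\<nexists>y. y - P y \<noteq> 0"
    then have "P = id_blinfun" by (intro blinfun_eqI) simp
    then show False using ne(2) by contradiction
  qed
  then obtain y where "y - P y \<noteq> 0" ..
  define e where "e = (1 / norm (P x)) *\<^sub>R P x"
  define f where "f = (1 / norm (y - P y)) *\<^sub>R (y - P y)"
  have "norm e = 1" "norm f = 1"
    using \<open>P x \<noteq> 0\<close> \<open>y - P y \<noteq> 0\<close> by (simp_all add: e_def f_def)
  then have ee: "cinner e e = 1" and ff: "cinner f f = 1"
    by (simp_all add: cinner_self)
  have Pe: "P e = e" by (simp add: e_def blinfun.bilinear_simps idem)
  have Pf: "P f = 0" by (simp add: f_def blinfun.bilinear_simps idem)
  note e = Pe ee and f = Pf ff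
  have "cinner e f = 0"
    using effectsD(1)[OF PE, of e f] by (simp add: Pe Pf)
  then have ef: "cinner e f = 0" "cinner f e = 0"
    using cinner_orth_commute by blast+
  define R where "R a b = P - rank1 e + rank1 (a *\<^sub>R e + b *\<^sub>R f)" for a b
  have R_apply: "R a b z = P z - cinner z e *\<^sub>C e + (of_real a * cinner z e + of_real b * cinner z f) *\<^sub>C
      (of_real a *\<^sub>C e + of_real b *\<^sub>C f)" for a b z
    by (simp add: R_def blinfun.bilinear_simps rank1.rep_eq cinner_simps scaleR_scaleC)
  have Pz: "cinner (P z) e = cinner z e" "cinner (P z) f = 0" for z
    by (simp_all add: effectsD(1)[OF PE] e f)
  have R_ext: "extreme_effect (R a b)" if ab: "a\<^sup>2 + b\<^sup>2 = 1" for a b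
  proof -
    define v where "v = a *\<^sub>R e + b *\<^sub>R f"
    have v: "P v = a *\<^sub>R e" "cinner v e = of_real a" "cinner e v = of_real a"
      by (simp_all add: v_def blinfun.bilinear_simps cinner_simps e f ef)
    have vv: "cinner v v = 1"
      using ab by (simp add: v_def cinner_simps e f ef power2_eq_square flip: of_real_mult of_real_add)
    have Pv: "cinner (P z) v = of_real a * cinner z e" for z
      by (simp add: v_def cinner_simps Pz)
    have Rv: "R a b z = P z - cinner z e *\<^sub>C e + cinner z v *\<^sub>C v" for z
      by (simp add: R_def v_def blinfun.bilinear_simps rank1.rep_eq)
    have PC: "P (c *\<^sub>C z) = c *\<^sub>C P z" for c z by (rule effects_scaleC[OF PE])
    have idemR: "R a b (R a b z) = R a b z" for z
      by (simp add: Rv blinfun.bilinear_simps PC idem e v Pv Pz vv cinner_simps scaleR_scaleC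
          scaleC_scaleC complex_vector.scale_left_diff_distrib scaleC_add_left mult.commute)
    have sym: "cinner (R a b z) w = cinner z (R a b w)" for z w
      by (simp add: R_def blinfun.bilinear_simps cinner_simps rank1_symmetric effectsD(1)[OF PE])
    have qR: "qform (R a b) z = (norm (R a b z))\<^sup>2" for z
      by (metis Re_cinner_self idemR qform_def sym)
    have "qform (R a b) z \<le> (norm z)\<^sup>2" for z
    proof -
      have "0 \<le> (norm (z - R a b z))\<^sup>2" by simp
      also have "\<dots> = (norm z)\<^sup>2 - qform (R a b) z"
        using qR[of z] Re_cinner_commute[of "R a b z" z]
        by (simp add: norm_diff_sq_cinner qform_def)
      finally show ?thesis by simp
    qed
    then have "R a b \<in> effects" using sym qR by (simp add: effects_iff)
    then show ?thesis using idemR by (rule extreme_effectI_idem)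
  qed
  have R_qf: "qform (R a b) f = b\<^sup>2" for a b
    by (simp add: qform_def R_apply f ef cinner_simps power2_eq_square)
  have PR: "P = R 1 0" by (simp add: R_def)
  \<comment> \<open>The parameters of the crossing: \<open>t\<close> is the position on the chord from \<open>P\<close>, and \<open>s\<close> that on
      the chord between \<open>R c (-d)\<close> and \<open>R c d\<close>.\<close>
  have cross: "crossing (R 1 0) (R a b) (R c d) (R c (-d))"
    if t: "0 \<le> t" "t \<le> 1" and s: "0 \<le> s" "s \<le> 1" and ab: "a\<^sup>2 + b\<^sup>2 = 1" "c\<^sup>2 + d\<^sup>2 = 1"
      "t * b\<^sup>2 = d\<^sup>2" "t * (a * b) = (2 * s - 1) * (c * d)" for a b c d s t
  proof -
    let ?S = "(1 - t) *\<^sub>R R 1 0 + t *\<^sub>R R a b" and ?T = "s *\<^sub>R R c d + (1 - s) *\<^sub>R R c (-d)"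
    have 1: "t * a\<^sup>2 = c\<^sup>2 + t - 1"
    proof -
      have "t * a\<^sup>2 + t * b\<^sup>2 = t" using ab(1) by (metis distrib_left mult.right_neutral)
      then show ?thesis using ab(2,3) by linarith
    qed
    have "?S = ?T"
    proof (rule blinfun_eqI)
      fix z
      define p q where "p = cinner z e" and "q = cinner z f"
      define u where "u = P z - p *\<^sub>C e"
      have Rz: "R a b z = u + (of_real (a\<^sup>2) * p + of_real (a * b) * q) *\<^sub>C e + (of_real (a * b) * p + of_real (b\<^sup>2) * q) *\<^sub>C f" for a b
        by (simp add: R_apply u_def p_def q_def complex_vector.scale_right_distrib scaleC_scaleC scaleC_add_left power2_eq_square
            distrib_left distrib_right mult.commute mult.left_commute add.commute add.left_commute)
      have comb: "(1 - r) *\<^sub>R (u + x *\<^sub>C e + y *\<^sub>C f) + r *\<^sub>R (u + x' *\<^sub>C e + y' *\<^sub>C f) =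
          u + (x + of_real r * (x' - x)) *\<^sub>C e + (y + of_real r * (y' - y)) *\<^sub>C f" for r x y x' y'
        by (simp add: scaleR_scaleC scaleC_add_left complex_vector.scale_right_distrib scaleC_scaleC
            complex_vector.scale_left_diff_distrib algebra_simps)
      have S: "?S z = u + (p + of_real t * (of_real (a\<^sup>2) * p + of_real (a * b) * q - p)) *\<^sub>C e
          + (of_real t * (of_real (a * b) * p + of_real (b\<^sup>2) * q)) *\<^sub>C f"
        by (simp only: blinfun.bilinear_simps Rz comb) simp
      have T: "?T z = u + (of_real (c\<^sup>2) * p + of_real (c * (-d)) * q + of_real s * (2 * of_real (c * d) * q)) *\<^sub>C e
          + (of_real (c * (-d)) * p + of_real (d\<^sup>2) * q + of_real s * (2 * of_real (c * d) * p)) *\<^sub>C f"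
        by (simp only: blinfun.bilinear_simps Rz add.commute[of "s *\<^sub>R _"] comb) (simp add: mult.commute mult.left_commute)
      have "p + of_real t * (of_real (a\<^sup>2) * p + of_real (a * b) * q - p) =
          of_real (1 + t * a\<^sup>2 - t) * p + of_real (t * (a * b)) * q"
        by (simp add: algebra_simps)
      also have "\<dots> = of_real (c\<^sup>2) * p + of_real (c * (-d)) * q + of_real s * (2 * of_real (c * d) * q)"
        by (simp only: ab(4) 1) (simp add: algebra_simps)
      finally have x: "p + of_real t * (of_real (a\<^sup>2) * p + of_real (a * b) * q - p) = \<dots>" .
      have "of_real t * (of_real (a * b) * p + of_real (b\<^sup>2) * q) =
          of_real (t * (a * b)) * p + of_real (t * b\<^sup>2) * q"
        by (simp add: algebra_simps)
      also have "\<dots> = of_real (c * (-d)) * p + of_real (d\<^sup>2) * q + of_real s * (2 * of_real (c * d) * p)"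
        by (simp only: ab(3,4)) (simp add: algebra_simps)
      finally have y: "of_real t * (of_real (a * b) * p + of_real (b\<^sup>2) * q) = \<dots>" .
      show "?S z = ?T z"
        unfolding S T x y ..
    qed
    moreover have "mixture ?S (R 1 0) (R a b)"
      unfolding mixture_def using t by (intro bexI[of _ "1 - t"]) auto
    moreover have "mixture ?T (R c d) (R c (-d))"
      unfolding mixture_def using s by (intro bexI[of _ s]) auto
    ultimately show ?thesis unfolding crossing_def by metis
  qed
  have "crossing P (R 0 1) (R (3/5) (4/5)) (R (3/5) (-(4/5)))"
    unfolding PR by (rule cross[of "16/25" "1/2"]) (auto simp: power2_eq_square)
  moreover have "crossing P (R (5/13) (12/13)) (R (3/5) (4/5)) (R (3/5) (-(4/5)))"
    unfolding PR by (rule cross[of "169/225" "7/9"]) (auto simp: power2_eq_square)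
  moreover have "extreme_effect (R 0 1)" "extreme_effect (R (5/13) (12/13))"
      "extreme_effect (R (3/5) (4/5))" "extreme_effect (R (3/5) (-(4/5)))"
    by (rule R_ext; simp add: power2_eq_square)+
  moreover have "R a b \<noteq> R c d" if "b\<^sup>2 \<noteq> d\<^sup>2" for a b c d
    using R_qf[of a b] R_qf[of c d] that by metis
  then have "R 0 1 \<noteq> R (5/13) (12/13)" "P \<noteq> R (3/5) (4/5)" "P \<noteq> R (3/5) (-(4/5))"
    "R 0 1 \<noteq> R (3/5) (4/5)" "R 0 1 \<noteq> R (3/5) (-(4/5))"
    "R (5/13) (12/13) \<noteq> R (3/5) (4/5)" "R (5/13) (12/13) \<noteq> R (3/5) (-(4/5))"
    unfolding PR by (auto simp: power2_eq_square)
  ultimately show ?thesis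
    unfolding doubly_crossed_def
    by (intro exI[of _ "R 0 1"] exI[of _ "R (5/13) (12/13)"] exI[of _ "R (3/5) (4/5)"]
        exI[of _ "R (3/5) (-(4/5))"] conjI)
qed

lemma mixture_automorphism_0_or_id:
  assumes \<phi>: "mixture_automorphism \<phi>"
  shows "\<phi> 0 \<in> {0, id_blinfun}" "\<phi> id_blinfun \<in> {0, id_blinfun}"
proof -
  have aux: "\<phi> A \<in> {0, id_blinfun}" if A: "extreme_effect A" "\<not> doubly_crossed A" for A
  proof (rule ccontr)
    assume "\<not> ?thesis"
    then have "doubly_crossed (\<phi> A)"
      using projection_doubly_crossed[OF extreme_effect_image[OF \<phi> A(1)]] by auto
    then have "doubly_crossed (inv_into effects \<phi> (\<phi> A))"
      using doubly_crossed_image[OF mixture_automorphism_inv[OF \<phi>]] extreme_effect_image[OF \<phi> A(1)] by blast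
    then show False using A mixture_automorphism_inv_apply(1)[OF \<phi>] by (simp add: extreme_effect_def)
  qed
  show "\<phi> 0 \<in> {0, id_blinfun}"
    using not_doubly_crossed_0 by (intro aux extreme_effectI_idem) auto
  show "\<phi> id_blinfun \<in> {0, id_blinfun}"
    using not_doubly_crossed_id by (intro aux extreme_effectI_idem) auto
qed

section \<open>Planes through the scalar operators\<close>

definition scalar_op :: "('a::real_normed_vector \<Rightarrow>\<^sub>L 'a) \<Rightarrow> bool" where
  "scalar_op A \<longleftrightarrow> (\<exists>c. A = c *\<^sub>R id_blinfun)"

text \<open>Coordinates in the plane of \<open>A\<close> and the identity, chosen so that the unit square
  becomes the parallelogram with corners \<open>0\<close>, \<open>A\<close>, the identity and its difference with \<open>A\<close>.\<close>

definition plane_point :: "('a::real_normed_vector \<Rightarrow>\<^sub>L 'a) \<Rightarrow> real \<times> real \<Rightarrow> ('a \<Rightarrow>\<^sub>L 'a)" where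
  "plane_point A p = fst p *\<^sub>R A + snd p *\<^sub>R (id_blinfun - A)"

text \<open>The plane of \<open>A\<close> and the identity meets the set of effects in the parallelogram spanned
  by \<open>A\<close> and \<open>I - A\<close> and in nothing more. Equivalently, the spectrum of \<open>A\<close> reaches both
  \<open>0\<close> and \<open>1\<close>.\<close>

definition square_corner :: "('a::complex_inner \<Rightarrow>\<^sub>L 'a) \<Rightarrow> bool" where
  "square_corner A \<longleftrightarrow> A \<in> effects \<and> (\<forall>p. plane_point A p \<in> effects \<longrightarrow> p \<in> unit_square)"

lemma scalar_op_scaleR [simp]: "scalar_op (c *\<^sub>R id_blinfun)"
  by (auto simp: scalar_op_def)

lemma scalar_op_0 [simp]: "scalar_op 0" and scalar_op_id [simp]: "scalar_op id_blinfun"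
  using scalar_op_scaleR[of 0] scalar_op_scaleR[of 1] by simp_all

lemma scalar_op_combination:
  assumes "a *\<^sub>R A = b *\<^sub>R id_blinfun" "a \<noteq> 0"
  shows "scalar_op A"
proof -
  have "A = (b / a) *\<^sub>R id_blinfun"
    using arg_cong[OF assms(1), of "\<lambda>X. (1 / a) *\<^sub>R X"] assms(2) by simp
  then show ?thesis by (metis scalar_op_scaleR)
qed

lemma plane_point_eq: "plane_point A (x, y) = (x - y) *\<^sub>R A + y *\<^sub>R id_blinfun"
  by (simp add: plane_point_def algebra_simps)

lemma plane_point_corners:
  "plane_point A (1, 0) = A" "plane_point A (0, 1) = id_blinfun - A"
  "plane_point A (0, 0) = 0" "plane_point A (1, 1) = id_blinfun"
  by (simp_all add: plane_point_def)

lemma plane_point_linear: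
  "plane_point A (t *\<^sub>R p + s *\<^sub>R q) = t *\<^sub>R plane_point A p + s *\<^sub>R plane_point A q"
  by (simp add: plane_point_def algebra_simps)

lemma plane_point_mixture:
  "mixture p q r \<Longrightarrow> mixture (plane_point A p) (plane_point A q) (plane_point A r)"
  by (auto simp: mixture_def plane_point_linear)

lemma plane_point_swap: "plane_point (id_blinfun - A) (x, y) = plane_point A (y, x)"
  by (simp add: plane_point_def)

lemma plane_point_effect:
  assumes "A \<in> effects" "p \<in> unit_square"
  shows "plane_point A p \<in> effects"
proof -
  obtain x y where p: "p = (x, y)" "0 \<le> x" "x \<le> 1" "0 \<le> y" "y \<le> 1"
    using assms(2) by (cases p) (auto simp: unit_square_def)
  have qf: "qform (plane_point A p) v = x * qform A v + y * ((norm v)\<^sup>2 - qform A v)" for v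
    by (simp add: p plane_point_def qform_simps)
  have "0 \<le> qform (plane_point A p) v \<and> qform (plane_point A p) v \<le> (norm v)\<^sup>2" for v
  proof -
    have q: "0 \<le> qform A v" "0 \<le> (norm v)\<^sup>2 - qform A v"
      using effectsD(2,3)[OF assms(1)] by auto
    have "0 \<le> x * qform A v" "0 \<le> y * ((norm v)\<^sup>2 - qform A v)"
      using q p(2-5) by (simp_all del: diff_ge_0_iff_ge)
    moreover have "x * qform A v \<le> qform A v" "y * ((norm v)\<^sup>2 - qform A v) \<le> (norm v)\<^sup>2 - qform A v"
      by (rule mult_left_le_one_le[OF q(1) p(2,3)], rule mult_left_le_one_le[OF q(2) p(4,5)])
    ultimately show ?thesis unfolding qf by linarith
  qed
  moreover have "cinner (plane_point A p v) w = cinner v (plane_point A p w)" for v w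
    by (simp add: plane_point_def blinfun.bilinear_simps cinner_simps effectsD(1)[OF assms(1)])
  ultimately show ?thesis by (simp add: effects_iff)
qed

lemma nonscalar_id_nonzero:
  fixes A :: "'a::real_normed_vector \<Rightarrow>\<^sub>L 'a"
  assumes "\<not> scalar_op A"
  shows "(id_blinfun :: 'a \<Rightarrow>\<^sub>L 'a) \<noteq> 0"
proof
  assume z: "(id_blinfun :: 'a \<Rightarrow>\<^sub>L 'a) = 0"
  have "A x = blinfun_apply 0 x" for x
    using arg_cong[OF z, of "\<lambda>B. blinfun_apply B (A x)"] by simp
  then have "A = 0" by (rule blinfun_eqI)
  then show False using assms by simp
qed

lemma plane_point_inject:
  assumes A: "\<not> scalar_op A"
  shows "plane_point A p = plane_point A q \<longleftrightarrow> p = q"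
proof
  assume eq: "plane_point A p = plane_point A q"
  obtain x y x' y' where p: "p = (x, y)" "q = (x', y')" by (cases p; cases q)
  have "(x - y - (x' - y')) *\<^sub>R A = (y' - y) *\<^sub>R id_blinfun"
    using eq by (simp add: p plane_point_eq algebra_simps)
  then have *: "x - y - (x' - y') = 0"
    using scalar_op_combination A by blast
  then have "(y' - y) *\<^sub>R (id_blinfun :: 'a \<Rightarrow>\<^sub>L 'a) = 0"
    using \<open>(x - y - (x' - y')) *\<^sub>R A = _\<close> by simp
  then have "y' = y" using nonscalar_id_nonzero[OF A] by simp
  then show "p = q" using * p by simp
qed simp

lemma square_corner_compl: "square_corner A \<Longrightarrow> square_corner (id_blinfun - A)"
  unfolding square_corner_def unit_square_def
  by (auto simp: plane_point_swap dest: spec[of _ "(_, _)"])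

text \<open>The plane of a scalar operator degenerates to a line, whose points also have coordinates
  outside the square.\<close>

lemma square_corner_nonscalar:
  assumes "square_corner A"
  shows "\<not> scalar_op A"
proof
  assume "scalar_op A"
  then obtain c where c: "A = c *\<^sub>R id_blinfun" by (auto simp: scalar_op_def)
  have pp: "plane_point A (x, y) = (x * c + y * (1 - c)) *\<^sub>R id_blinfun" for x y
    by (simp add: plane_point_def c algebra_simps)
  have "plane_point A (1, 2) \<in> effects" if "c = 1"
    by (simp add: pp that)
  moreover have "plane_point A (2, - 2 * c / (1 - c)) \<in> effects" if "c \<noteq> 1"
    by (simp add: pp that)
  ultimately have "(1::real, 2::real) \<in> unit_square \<or> (2, - 2 * c / (1 - c)) \<in> unit_square"
    using assms unfolding square_corner_def by blast
  then show False by (simp add: unit_square_def)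
qed

lemma affine_nonneg_Inf_Sup:
  fixes S :: "real set"
  assumes S: "S \<noteq> {}" "bdd_below S" "bdd_above S" and nonneg: "\<And>q. q \<in> S \<Longrightarrow> 0 \<le> a + b * q"
  shows "0 \<le> a + b * Inf S" "0 \<le> a + b * Sup S"
proof -
  obtain q where q: "q \<in> S" using S by blast
  have m: "Inf S \<le> q" "q \<le> Sup S" using q S by (auto intro: cInf_lower cSup_upper)
  show "0 \<le> a + b * Inf S"
  proof (cases "0 < b")
    case True
    have "- a / b \<le> Inf S"
    proof (rule cInf_greatest[OF S(1)])
      fix r assume "r \<in> S"
      then have "- a \<le> r * b" using nonneg[of r] by (simp add: mult.commute)
      then show "- a / b \<le> r" using True by (simp only: pos_divide_le_eq)
    qed
    then show ?thesis using True by (simp only: pos_divide_le_eq) (simp add: mult.commute)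
  next
    case False
    then have "b * q \<le> b * Inf S" using m by (simp add: mult_left_mono_neg)
    then show ?thesis using nonneg[OF q] by simp
  qed
  show "0 \<le> a + b * Sup S"
  proof (cases "b < 0")
    case True
    have "Sup S \<le> a / (- b)"
    proof (rule cSup_least[OF S(1)])
      fix r assume "r \<in> S"
      then have "r * (- b) \<le> a" using nonneg[of r] by (simp add: mult.commute)
      then show "r \<le> a / (- b)" using True by (simp only: pos_le_divide_eq neg_0_less_iff_less)
    qed
    then have "Sup S * (- b) \<le> a" using True by (simp only: pos_le_divide_eq neg_0_less_iff_less)
    then show ?thesis by (simp add: mult.commute)
  next
    case False
    then have "b * q \<le> b * Sup S" using m by (simp add: mult_left_mono)
    then show ?thesis using nonneg[OF q] by simp
  qed
qed

text \<open>Subtracting the infimum of the numerical range and rescaling its length to \<open>1\<close> gives the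
  corner. Bounds on the form extend from the numerical range to its infimum and supremum because they
  are affine (\<open>affine_nonneg_Inf_Sup\<close>), whether or not these are attained.\<close>

lemma square_corner_exists:
  fixes A :: "'a::complex_inner \<Rightarrow>\<^sub>L 'a"
  assumes A: "A \<in> effects" "\<not> scalar_op A"
  obtains A0 x y where "square_corner A0" "(x, y) \<in> unit_square" "A = plane_point A0 (x, y)"
proof -
  define S where "S = qform A ` {v. norm v = 1}"
  have S01: "0 \<le> q \<and> q \<le> 1" if "q \<in> S" for q
    using that effectsD(2,3)[OF A(1)] by (auto simp: S_def) (metis one_power2)
  obtain v :: 'a where "v \<noteq> 0"
  proof -
    have "A \<noteq> 0" using A(2) by auto
    then obtain v where "A v \<noteq> 0" by (metis blinfun_eqI zero_blinfun.rep_eq)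
    then have "v \<noteq> 0" by auto
    then show ?thesis by (rule that)
  qed
  then have "norm ((1 / norm v) *\<^sub>R v) = 1" by simp
  then have ne: "S \<noteq> {}" unfolding S_def by blast
  have bdd: "bdd_below S" "bdd_above S" using S01 by (meson bdd_belowI bdd_aboveI)+
  define m where "m = Inf S"
  define M where "M = Sup S"
  have mM: "m \<le> q" "q \<le> M" if "q \<in> S" for q
    using that bdd by (auto simp: m_def M_def intro: cInf_lower cSup_upper)
  have m0: "0 \<le> m" "M \<le> 1" unfolding m_def M_def
    using S01 ne by (auto intro: cInf_greatest cSup_least)
  have "m \<le> M" using ne mM by fastforce
  have bounds: "m * (norm w)\<^sup>2 \<le> qform A w \<and> qform A w \<le> M * (norm w)\<^sup>2" for w
  proof (cases "w = 0")
    case False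
    define u where "u = (1 / norm w) *\<^sub>R w"
    have "qform A u \<in> S" unfolding S_def u_def using False by (intro imageI) simp
    moreover have "qform A w = (norm w)\<^sup>2 * qform A u"
      using qform_scaleR[of A "norm w" u] False by (simp add: u_def)
    ultimately show ?thesis
      using mM[of "qform A u"] by (simp add: mult.commute[of "(norm w)\<^sup>2"] mult_right_mono del: mult_le_cancel_right)
  qed (simp add: qform_def)
  have "m \<noteq> M"
  proof
    assume "m = M"
    then have "qform A w = qform (m *\<^sub>R id_blinfun) w" for w
      using bounds[of w] by (simp add: qform_simps)
    moreover have "m *\<^sub>R id_blinfun \<in> effects"
      using m0 \<open>m \<le> M\<close> by (intro scaleR_effect) auto
    ultimately have "A = m *\<^sub>R id_blinfun" using A(1) by (intro qform_eqI)
    then show False using A(2) by simp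
  qed
  then have lt: "m < M" using \<open>m \<le> M\<close> by simp
  define A0 where "A0 = (1 / (M - m)) *\<^sub>R (A - m *\<^sub>R id_blinfun)"
  have q0: "qform A0 w = (qform A w - m * (norm w)\<^sup>2) / (M - m)" for w
    by (simp add: A0_def qform_simps)
  have "qform A0 w \<le> (norm w)\<^sup>2" for w
    using bounds[of w] lt by (simp add: q0 pos_divide_le_eq algebra_simps)
  moreover have "0 \<le> qform A0 w" for w
    using bounds[of w] lt by (simp add: q0)
  moreover have "cinner (A0 x) y = cinner x (A0 y)" for x y
    by (simp add: A0_def blinfun.bilinear_simps cinner_simps effectsD(1)[OF A(1)])
  ultimately have A0: "A0 \<in> effects" by (simp add: effects_iff)
  have "(M - m) *\<^sub>R A0 = A - m *\<^sub>R id_blinfun"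
    using lt by (simp add: A0_def)
  then have AA: "A = plane_point A0 (M, m)"
    by (simp add: plane_point_eq)
  have "square_corner A0"
    unfolding square_corner_def
  proof (intro conjI allI impI A0)
    fix p assume p: "plane_point A0 p \<in> effects"
    obtain x y where xy: "p = (x, y)" by (cases p)
    define b where "b = (x - y) / (M - m)"
    have "0 \<le> (y - b * m) + b * q" "0 \<le> (1 - y + b * m) + (- b) * q" if q: "q \<in> S" for q
    proof -
      obtain w where w: "norm w = 1" "q = qform A w" using q by (auto simp: S_def)
      have "qform (plane_point A0 p) w = (x - y) * ((q - m) / (M - m)) + y"
        by (simp add: xy plane_point_eq qform_simps q0 w)
      also have "\<dots> = (y - b * m) + b * q"
      proof -
        have "(x - y) * ((q - m) / (M - m)) = b * (q - m)" by (simp add: b_def)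
        then show ?thesis by (simp add: algebra_simps)
      qed
      finally show "0 \<le> (y - b * m) + b * q" "0 \<le> (1 - y + b * m) + (- b) * q"
        using effectsD(2,3)[OF p, of w] w(1) by simp_all
    qed
    note bnd = affine_nonneg_Inf_Sup[OF ne bdd this(1), folded m_def M_def]
      affine_nonneg_Inf_Sup[OF ne bdd this(2), folded m_def M_def]
    have "b * (M - m) = x - y" using lt by (simp add: b_def)
    then have "b * M = x - y + b * m" by (simp add: algebra_simps)
    with bnd show "p \<in> unit_square" by (simp add: xy unit_square_def)
  qed
  moreover have "(M, m) \<in> unit_square" using m0 \<open>m \<le> M\<close> by (simp add: unit_square_def)
  ultimately show ?thesis using AA that by blast
qed

lemma mixture_corner:
  assumes "mixture (1, 0) p q" "p \<in> unit_square" "q \<in> unit_square"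
  shows "p = (1, 0) \<or> q = (1::real, 0::real)"
proof -
  obtain x y x' y' where p: "p = (x, y)" "q = (x', y')" by (cases p; cases q)
  have xy: "x \<le> 1" "0 \<le> y" "x' \<le> 1" "0 \<le> y'" using assms(2,3) by (auto simp: p unit_square_def)
  obtain t where t: "0 \<le> t" "t \<le> 1" "1 = t * x + (1 - t) * x'" "0 = t * y + (1 - t) * y'"
    using assms(1) by (auto simp: p mixture_pair)
  show ?thesis
  proof (cases "t = 0 \<or> t = 1")
    case False
    have "t * (1 - x) + (1 - t) * (1 - x') = 0" using t by (simp add: algebra_simps)
    moreover have "0 \<le> t * (1 - x)" "0 \<le> (1 - t) * (1 - x')" using t xy by auto
    ultimately have "t * (1 - x) = 0" by linarith
    moreover have "0 \<le> t * y" "0 \<le> (1 - t) * y'" using t xy by auto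
    then have "t * y = 0" using t(4) by linarith
    ultimately show ?thesis using False by (simp add: p)
  qed (use t p in auto)
qed

lemma square_corner_extreme_in_plane:
  assumes A: "square_corner A" and "plane_point A p \<in> effects" "plane_point A q \<in> effects"
    and "mixture A (plane_point A p) (plane_point A q)"
  shows "A = plane_point A p \<or> A = plane_point A q"
proof -
  obtain t where t: "t \<in> {0..1}" "A = t *\<^sub>R plane_point A p + (1 - t) *\<^sub>R plane_point A q"
    using assms(4) by (auto simp: mixture_def)
  then have "plane_point A (1, 0) = plane_point A (t *\<^sub>R p + (1 - t) *\<^sub>R q)"
    by (simp add: plane_point_linear plane_point_corners)
  then have "(1, 0) = t *\<^sub>R p + (1 - t) *\<^sub>R q"
    using plane_point_inject[OF square_corner_nonscalar[OF A]] by blast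
  then have "mixture (1, 0) p q" using t(1) unfolding mixture_def by blast
  then have "p = (1, 0) \<or> q = (1, 0)"
    using assms(1-3) unfolding square_corner_def by (intro mixture_corner) blast+
  then show ?thesis by (auto simp: plane_point_corners)
qed

text \<open>The extreme points of a square are its corners, and two of the four corners are
  scalar.\<close>

lemma extreme_in_plane_corner:
  assumes A: "square_corner A" and X: "X = plane_point A p" "X \<in> effects" "\<not> scalar_op X"
    and ext: "\<And>q r. q \<in> unit_square \<Longrightarrow> r \<in> unit_square \<Longrightarrow>
      mixture X (plane_point A q) (plane_point A r) \<Longrightarrow> X = plane_point A q \<or> X = plane_point A r"
  shows "X = A \<or> X = id_blinfun - A"
proof -
  obtain x y where p: "p = (x, y)" by (cases p)
  have xy: "0 \<le> x" "x \<le> 1" "0 \<le> y" "y \<le> 1"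
    using A X by (auto simp: square_corner_def unit_square_def p)
  have "mixture (x, y) (1, y) (0, y)" "mixture (x, y) (x, 1) (x, 0)"
    using xy by (auto simp: mixture_pair algebra_simps)
  note this[THEN plane_point_mixture[of _ _ _ A]]
  then have "X = plane_point A (1, y) \<or> X = plane_point A (0, y)"
     "X = plane_point A (x, 1) \<or> X = plane_point A (x, 0)"
    using xy ext X(1) p by (auto simp: unit_square_def)
  then have "x = 1 \<or> x = 0" "y = 1 \<or> y = 0"
    using plane_point_inject[OF square_corner_nonscalar[OF A]] X(1) p by auto
  then show ?thesis
    using X(1,3) p plane_point_corners[of A] by auto
qed

definition coplanar_with_scalars where
  "coplanar_with_scalars A X \<longleftrightarrow> (\<exists>p. X = plane_point A p)"

lemma coplanar_plane_point: "coplanar_with_scalars A (plane_point A p)"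
  unfolding coplanar_with_scalars_def by blast

lemma coplanar_iff: "coplanar_with_scalars A X \<longleftrightarrow> (\<exists>a b. X = b *\<^sub>R A + a *\<^sub>R id_blinfun)"
proof
  assume "\<exists>a b. X = b *\<^sub>R A + a *\<^sub>R id_blinfun"
  then obtain a b where "X = b *\<^sub>R A + a *\<^sub>R id_blinfun" by blast
  then have "X = plane_point A (a + b, a)" by (simp add: plane_point_eq)
  then show "coplanar_with_scalars A X" unfolding coplanar_with_scalars_def by blast
next
  assume "coplanar_with_scalars A X"
  then obtain x y where "X = plane_point A (x, y)" by (auto simp: coplanar_with_scalars_def)
  then show "\<exists>a b. X = b *\<^sub>R A + a *\<^sub>R id_blinfun" by (auto simp: plane_point_eq)
qed

lemma coplanar_trans:
  assumes "coplanar_with_scalars A X" "coplanar_with_scalars X Y"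
  shows "coplanar_with_scalars A Y"
proof -
  obtain a b a' b' where "X = b *\<^sub>R A + a *\<^sub>R id_blinfun" "Y = b' *\<^sub>R X + a' *\<^sub>R id_blinfun"
    using assms by (auto simp: coplanar_iff)
  then have "Y = (b' * b) *\<^sub>R A + (b' * a + a') *\<^sub>R id_blinfun"
    by (simp add: algebra_simps)
  then show ?thesis unfolding coplanar_iff by blast
qed

lemma coplanar_sym:
  assumes "coplanar_with_scalars A X" "\<not> scalar_op X"
  shows "coplanar_with_scalars X A"
proof -
  obtain a b where X: "X = b *\<^sub>R A + a *\<^sub>R id_blinfun"
    using assms(1) by (auto simp: coplanar_iff)
  then have "b \<noteq> 0" using assms(2) by auto
  then have "A = (1 / b) *\<^sub>R X + (- a / b) *\<^sub>R id_blinfun"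
    by (simp add: X algebra_simps)
  then show ?thesis unfolding coplanar_iff by blast
qed

section \<open>Affinity of mixture automorphisms\<close>

text \<open>A nonscalar effect exists as soon as the dimension is at least two; in dimension one the
  effects form an interval, and every increasing bijection of it preserves mixtures.\<close>

locale unital_mixture_automorphism =
  fixes \<phi> :: "('a::complex_inner \<Rightarrow>\<^sub>L 'a) \<Rightarrow> ('a \<Rightarrow>\<^sub>L 'a)"
  assumes automorphism: "mixture_automorphism \<phi>"
    and image_zero: "\<phi> 0 = 0"
    and image_id: "\<phi> id_blinfun = id_blinfun"
    and nonscalar_exists: "\<exists>A::'a \<Rightarrow>\<^sub>L 'a. A \<in> effects \<and> \<not> scalar_op A"
begin

lemmas image_effect = mixture_automorphism_effect[OF automorphism]
  and image_eq_iff = mixture_automorphism_eq_iff[OF automorphism]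
  and image_mixture = mixture_automorphism_mixture[OF automorphism]
  and inv_image = mixture_automorphism_inv_apply[OF automorphism]

lemma inverse: "unital_mixture_automorphism (inv_into effects \<phi>)"
proof
  show "mixture_automorphism (inv_into effects \<phi>)"
    by (rule mixture_automorphism_inv[OF automorphism])
  show "inv_into effects \<phi> 0 = 0" "inv_into effects \<phi> id_blinfun = id_blinfun"
    using inv_image(1)[of 0] inv_image(1)[of id_blinfun] by (simp_all add: image_zero image_id)
  show "\<exists>A::'a \<Rightarrow>\<^sub>L 'a. A \<in> effects \<and> \<not> scalar_op A"
    by (rule nonscalar_exists)
qed

lemma inverse_effect: "A \<in> effects \<Longrightarrow> inv_into effects \<phi> A \<in> effects"
  using mixture_automorphism_effect[OF mixture_automorphism_inv[OF automorphism]] .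

text \<open>The scalar effects form the segment between the two fixed effects.\<close>

lemma scalar_image:
  assumes "X \<in> effects" "scalar_op X"
  shows "scalar_op (\<phi> X)"
proof -
  obtain A :: "'a \<Rightarrow>\<^sub>L 'a" where A: "A \<in> effects" "\<not> scalar_op A"
    using nonscalar_exists by blast
  then have "A \<noteq> 0" by auto
  then obtain v where "A v \<noteq> 0" by (metis blinfun_eqI zero_blinfun.rep_eq)
  then have v: "0 < (norm v)\<^sup>2" by auto
  obtain c where c: "X = c *\<^sub>R id_blinfun" using assms(2) by (auto simp: scalar_op_def)
  have "0 \<le> c * (norm v)\<^sup>2" "c * (norm v)\<^sup>2 \<le> 1 * (norm v)\<^sup>2"
    using effectsD(2,3)[OF assms(1), of v] by (simp_all add: c qform_simps)
  then have "0 \<le> c" "c \<le> 1" using v by (auto simp: zero_le_mult_iff)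
  then have "mixture X id_blinfun 0"
    unfolding mixture_def c by (intro bexI[of _ c]) auto
  then have "mixture (\<phi> X) id_blinfun 0"
    using image_mixture[OF assms(1) id_effect zero_effect] by (simp add: image_zero image_id)
  then show ?thesis by (auto simp: mixture_def)
qed

end

context unital_mixture_automorphism
begin

\<comment> \<open>Properties are reflected, and not only preserved, because the inverse map has them too.\<close>
interpretation inv: unital_mixture_automorphism "inv_into effects \<phi>"
  by (rule inverse)

lemma scalar_image_iff: "X \<in> effects \<Longrightarrow> scalar_op (\<phi> X) \<longleftrightarrow> scalar_op X"
  using scalar_image inv.scalar_image[of "\<phi> X"] by (metis image_effect inv_image(1))

text \<open>If \<open>A\<close> and \<open>X\<close> lie on different sides of the line of scalars in their plane, then the
  segment between them contains a scalar operator. Its image is scalar and lies on the segment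
  between the images.\<close>

lemma coplanar_opposite:
  assumes A: "A \<in> effects" "\<not> scalar_op A" and X: "X \<in> effects"
    and comb: "X = b *\<^sub>R A + a *\<^sub>R id_blinfun" and b: "b < 0"
  shows "coplanar_with_scalars (\<phi> A) (\<phi> X)"
proof -
  define t where "t = 1 / (1 - b)"
  have t: "0 < t" "t \<le> 1" "t * b = t - 1" using b by (simp_all add: t_def field_simps)
  define M where "M = t *\<^sub>R X + (1 - t) *\<^sub>R A"
  have "M = (t * b + (1 - t)) *\<^sub>R A + (t * a) *\<^sub>R id_blinfun"
    by (simp add: M_def comb algebra_simps)
  then have M: "scalar_op M" using t by simp
  have mix: "mixture M X A" unfolding mixture_def M_def using t by (intro bexI[of _ t]) auto
  then have ME: "M \<in> effects" using mixture_effects A X by blast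
  obtain c where c: "\<phi> M = c *\<^sub>R id_blinfun"
    using scalar_image[OF ME M] by (auto simp: scalar_op_def)
  obtain s where s: "s \<in> {0..1}" "\<phi> M = s *\<^sub>R \<phi> X + (1 - s) *\<^sub>R \<phi> A"
    using mix image_mixture[OF ME X A(1)] by (auto simp: mixture_def)
  have "s \<noteq> 0"
    using s(2) scalar_image[OF ME M] scalar_image_iff[OF A(1)] A(2) by auto
  have "s *\<^sub>R \<phi> X = (s - 1) *\<^sub>R \<phi> A + c *\<^sub>R id_blinfun"
    using s c by (simp add: algebra_simps)
  then have "(1 / s) *\<^sub>R s *\<^sub>R \<phi> X = ((s - 1) / s) *\<^sub>R \<phi> A + (c / s) *\<^sub>R id_blinfun"
    by (simp only: scaleR_add_right scaleR_scaleR) simp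
  then have "\<phi> X = ((s - 1) / s) *\<^sub>R \<phi> A + (c / s) *\<^sub>R id_blinfun"
    using \<open>s \<noteq> 0\<close> by simp
  then show ?thesis unfolding coplanar_iff by blast
qed

text \<open>For \<open>X\<close> on the same side as \<open>A\<close>, pass through \<open>I - A\<close>, which lies on the other side.\<close>

lemma coplanar_image:
  assumes A: "A \<in> effects" "\<not> scalar_op A" and X: "X \<in> effects"
    and cop: "coplanar_with_scalars A X"
  shows "coplanar_with_scalars (\<phi> A) (\<phi> X)"
proof -
  obtain a b where ab: "X = b *\<^sub>R A + a *\<^sub>R id_blinfun"
    using cop by (auto simp: coplanar_iff)
  consider "b < 0" | "b = 0" | "b > 0" by linarith
  then show ?thesis
  proof cases
    case 1
    then show ?thesis using coplanar_opposite A X ab by blast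
  next
    case 2
    then have "scalar_op (\<phi> X)" using scalar_image X ab by simp
    then obtain c where "\<phi> X = 0 *\<^sub>R \<phi> A + c *\<^sub>R id_blinfun" by (auto simp: scalar_op_def)
    then show ?thesis unfolding coplanar_iff by blast
  next
    case 3
    have A': "id_blinfun - A = (-1) *\<^sub>R A + 1 *\<^sub>R id_blinfun" by simp
    have "A = (-1) *\<^sub>R (id_blinfun - A) + 1 *\<^sub>R id_blinfun" by simp
    have ns: "\<not> scalar_op (id_blinfun - A)"
    proof
      assume "scalar_op (id_blinfun - A)"
      then obtain c where "id_blinfun - A = c *\<^sub>R id_blinfun" by (auto simp: scalar_op_def)
      then have "1 *\<^sub>R A = (1 - c) *\<^sub>R id_blinfun" by (simp add: algebra_simps)
      then show False using A(2) scalar_op_combination[of 1] by simp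
    qed
    have X': "X = (- b) *\<^sub>R (id_blinfun - A) + (a + b) *\<^sub>R id_blinfun"
      by (simp add: ab algebra_simps)
    have "coplanar_with_scalars (\<phi> A) (\<phi> (id_blinfun - A))"
      by (rule coplanar_opposite[OF A _ A']) (use A in auto)
    moreover have "coplanar_with_scalars (\<phi> (id_blinfun - A)) (\<phi> X)"
      by (rule coplanar_opposite[OF _ ns X X']) (use A 3 in auto)
    ultimately show ?thesis by (rule coplanar_trans)
  qed
qed

end

context unital_mixture_automorphism
begin

interpretation inv: unital_mixture_automorphism "inv_into effects \<phi>"
  by (rule inverse)

text \<open>The image of the corner \<open>X\<close> is extreme in its planar section, because the inverse map carries
  this section back into the section of \<open>X\<close>, where \<open>X\<close> is extreme.\<close>

lemma corner_image_aux:
  assumes X: "square_corner X" and A0: "square_corner A0" and cop: "coplanar_with_scalars A0 (\<phi> X)"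
  shows "\<phi> X = A0 \<or> \<phi> X = id_blinfun - A0"
proof -
  have XE: "X \<in> effects" and A0E: "A0 \<in> effects" using X A0 by (auto simp: square_corner_def)
  note ns = square_corner_nonscalar[OF X]
  have ns': "\<not> scalar_op (\<phi> X)" using ns scalar_image_iff XE by simp
  have cop': "coplanar_with_scalars (\<phi> X) A0" by (rule coplanar_sym[OF cop ns'])
  obtain p where p: "\<phi> X = plane_point A0 p" using cop by (auto simp: coplanar_with_scalars_def)
  show ?thesis
  proof (rule extreme_in_plane_corner[OF A0 p image_effect[OF XE] ns'])
    fix q r assume qr: "q \<in> unit_square" "r \<in> unit_square"
      and mix: "mixture (\<phi> X) (plane_point A0 q) (plane_point A0 r)"
    have E: "plane_point A0 q \<in> effects" "plane_point A0 r \<in> effects"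
      using plane_point_effect[OF A0E] qr by auto
    define Q R where "Q = inv_into effects \<phi> (plane_point A0 q)"
      and "R = inv_into effects \<phi> (plane_point A0 r)"
    have QE: "Q \<in> effects" "R \<in> effects" and Q: "\<phi> Q = plane_point A0 q" "\<phi> R = plane_point A0 r"
      using E inverse_effect inv_image(2) by (auto simp: Q_def R_def)
    have "coplanar_with_scalars A0 (\<phi> Q)" "coplanar_with_scalars A0 (\<phi> R)"
      by (simp_all add: Q coplanar_plane_point)
    then have "coplanar_with_scalars (\<phi> X) (\<phi> Q)" "coplanar_with_scalars (\<phi> X) (\<phi> R)"
      using cop' coplanar_trans by blast+
    then have "coplanar_with_scalars X Q" "coplanar_with_scalars X R"
      using inv.coplanar_image[OF image_effect[OF XE] ns'] image_effect QE XE
      by (metis inv_image(1))+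
    then obtain q' r' where q': "Q = plane_point X q'" "R = plane_point X r'"
      by (auto simp: coplanar_with_scalars_def)
    have "mixture X Q R" using mix image_mixture[OF XE QE] by (simp add: Q)
    then have "X = Q \<or> X = R"
      using square_corner_extreme_in_plane[OF X, of q' r'] QE q' by simp
    then show "\<phi> X = plane_point A0 q \<or> \<phi> X = plane_point A0 r" using Q by auto
  qed
qed

lemma square_corner_image:
  assumes A: "square_corner A"
  shows "square_corner (\<phi> A)" "\<phi> (id_blinfun - A) = id_blinfun - \<phi> A"
proof -
  have AE: "A \<in> effects" using A by (simp add: square_corner_def)
  note ns = square_corner_nonscalar[OF A]
  have ns': "\<not> scalar_op (\<phi> A)" using ns scalar_image_iff AE by simp
  obtain A0 x y where A0: "square_corner A0" "\<phi> A = plane_point A0 (x, y)"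
    using square_corner_exists[OF image_effect[OF AE] ns'] by metis
  then have "\<phi> A = A0 \<or> \<phi> A = id_blinfun - A0"
    using A by (intro corner_image_aux) (auto simp: coplanar_with_scalars_def)
  then show sp: "square_corner (\<phi> A)" using A0(1) square_corner_compl by auto
  have "coplanar_with_scalars A (id_blinfun - A)"
    unfolding coplanar_with_scalars_def by (metis plane_point_corners(2))
  then have "coplanar_with_scalars (\<phi> A) (\<phi> (id_blinfun - A))"
    using coplanar_image AE ns by simp
  then have "\<phi> (id_blinfun - A) = \<phi> A \<or> \<phi> (id_blinfun - A) = id_blinfun - \<phi> A"
    using corner_image_aux[OF square_corner_compl[OF A] sp] by blast
  moreover have "id_blinfun - A \<noteq> A"
    using plane_point_inject[OF ns, of "(0, 1)" "(1, 0)"] by (simp add: plane_point_corners)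
  ultimately show "\<phi> (id_blinfun - A) = id_blinfun - \<phi> A"
    using image_eq_iff AE by auto
qed

lemma plane_point_image:
  assumes A: "square_corner A" and p: "p \<in> unit_square"
  shows "\<phi> (plane_point A p) = plane_point (\<phi> A) p"
proof -
  have AE: "A \<in> effects" using A by (simp add: square_corner_def)
  note ns = square_corner_nonscalar[OF A] and ns' = square_corner_nonscalar[OF square_corner_image(1)[OF A]]
  have E: "plane_point A q \<in> effects" if "q \<in> unit_square" for q
    using plane_point_effect[OF AE that] .
  define F where "F q = (SOME r. \<phi> (plane_point A q) = plane_point (\<phi> A) r)" for q
  have F: "\<phi> (plane_point A q) = plane_point (\<phi> A) (F q)" if "q \<in> unit_square" for q
  proof -
    have "\<exists>r. \<phi> (plane_point A q) = plane_point (\<phi> A) r"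
      using coplanar_image[OF AE ns E[OF that] coplanar_plane_point] by (simp only: coplanar_with_scalars_def)
    then show ?thesis unfolding F_def by (rule someI_ex)
  qed
  have Fc: "F q = r" if "q \<in> unit_square" "\<phi> (plane_point A q) = plane_point (\<phi> A) r" for q r
    using F[OF that(1)] that(2) plane_point_inject[OF ns'] by simp
  have "F p = p"
  proof (rule square_segment_map_id[OF _ _ _ _ _ _ p])
    show "mixture (F u) (F v) (F w)"
      if uvw: "u \<in> unit_square" "v \<in> unit_square" "w \<in> unit_square" and mix: "mixture u v w" for u v w
    proof -
      have "mixture (\<phi> (plane_point A u)) (\<phi> (plane_point A v)) (\<phi> (plane_point A w))"
        using image_mixture E uvw plane_point_mixture[OF mix] by simp
      then obtain t where t: "t \<in> {0..1}" "plane_point (\<phi> A) (F u) =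
          t *\<^sub>R plane_point (\<phi> A) (F v) + (1 - t) *\<^sub>R plane_point (\<phi> A) (F w)"
        using uvw by (auto simp: F mixture_def)
      then have "plane_point (\<phi> A) (F u) = plane_point (\<phi> A) (t *\<^sub>R F v + (1 - t) *\<^sub>R F w)"
        by (simp only: plane_point_linear)
      then have "F u = t *\<^sub>R F v + (1 - t) *\<^sub>R F w"
        by (simp only: plane_point_inject[OF ns'])
      then show ?thesis using t(1) unfolding mixture_def by blast
    qed
    show "inj_on F unit_square"
    proof (rule inj_onI)
      fix u v assume uv: "u \<in> unit_square" "v \<in> unit_square" "F u = F v"
      then have "\<phi> (plane_point A u) = \<phi> (plane_point A v)" by (simp add: F)
      then show "u = v" using image_eq_iff E uv plane_point_inject[OF ns] by simp
    qed
  qed (rule Fc; simp add: plane_point_corners image_zero image_id square_corner_image(2)[OF A] unit_square_def)+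
  then show ?thesis using F[OF p] by simp
qed

text \<open>A scalar effect lies on the diagonal of every square.\<close>

lemma effect_in_plane:
  fixes A :: "'a \<Rightarrow>\<^sub>L 'a"
  assumes "A \<in> effects"
  obtains A0 p where "square_corner A0" "p \<in> unit_square" "A = plane_point A0 p"
proof (cases "scalar_op A")
  case False
  then show ?thesis using square_corner_exists[OF assms] that by blast
next
  case True
  then obtain c where c: "A = c *\<^sub>R id_blinfun" by (auto simp: scalar_op_def)
  obtain B :: "'a \<Rightarrow>\<^sub>L 'a" where "B \<in> effects" "\<not> scalar_op B"
    using nonscalar_exists by blast
  then obtain A0 :: "'a \<Rightarrow>\<^sub>L 'a" and q where "square_corner A0" by (metis square_corner_exists)
  moreover have A': "A = plane_point A0 (c, c)" by (simp add: c plane_point_eq)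
  moreover have "(c, c) \<in> unit_square"
    using \<open>square_corner A0\<close> assms unfolding square_corner_def A' by blast
  ultimately show ?thesis using that by blast
qed

lemma image_scaleR:
  assumes A: "A \<in> effects" and t: "0 \<le> t" "t \<le> 1"
  shows "\<phi> (t *\<^sub>R A) = t *\<^sub>R \<phi> A"
proof -
  obtain A0 p where A0: "square_corner A0" "p \<in> unit_square" "A = plane_point A0 p"
    by (rule effect_in_plane[OF A])
  have "t *\<^sub>R p \<in> unit_square"
    using A0(2) t by (auto simp: unit_square_def mult_le_one)
  moreover have lin: "plane_point B (t *\<^sub>R p) = t *\<^sub>R plane_point B p" for B :: "'a \<Rightarrow>\<^sub>L 'a"
    using plane_point_linear[of B t p 0 0] by simp
  ultimately show ?thesis
    using plane_point_image[OF A0(1)] A0 by (metis lin)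
qed

lemma image_compl:
  assumes A: "A \<in> effects"
  shows "\<phi> (id_blinfun - A) = id_blinfun - \<phi> A"
proof -
  obtain A0 p where A0: "square_corner A0" "p \<in> unit_square" "A = plane_point A0 p"
    by (rule effect_in_plane[OF A])
  obtain x y where p: "p = (x, y)" by (cases p)
  have "(1 - x, 1 - y) \<in> unit_square" using A0(2) p by (simp add: unit_square_def)
  moreover have "plane_point B (1 - x, 1 - y) = id_blinfun - plane_point B p" for B :: "'a \<Rightarrow>\<^sub>L 'a"
    by (simp add: p plane_point_eq algebra_simps)
  ultimately show ?thesis
    using plane_point_image[OF A0(1)] A0 by metis
qed

text \<open>Proportional images have proportional preimages by homogeneity; a negative factor between
  effects is possible only if both vanish.\<close>

lemma image_independent:
  assumes E: "B \<in> effects" "C \<in> effects"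
    and ind: "\<And>k. 0 \<le> k \<Longrightarrow> k \<le> 1 \<Longrightarrow> B \<noteq> k *\<^sub>R C" "\<And>k. 0 \<le> k \<Longrightarrow> k \<le> 1 \<Longrightarrow> C \<noteq> k *\<^sub>R B"
    and comb: "p *\<^sub>R \<phi> B + r *\<^sub>R \<phi> C = 0"
  shows "p = 0" "r = 0"
proof -
  have no: "\<phi> X \<noteq> k *\<^sub>R \<phi> Y"
    if "X \<in> effects" "Y \<in> effects" "X \<noteq> k *\<^sub>R Y" "0 \<le> k" "k \<le> 1" for X Y k
    using that image_scaleR[of Y k] image_eq_iff[of X "k *\<^sub>R Y"] scaleR_effect[of Y k] by simp
  note noB = no[OF E ind(1)] and noC = no[OF E(2,1) ind(2)]
  show p: "p = 0"
  proof (rule ccontr)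
    assume "p \<noteq> 0"
    define k where "k = - r / p"
    have "p *\<^sub>R \<phi> B = (- r) *\<^sub>R \<phi> C" using comb by (simp add: eq_neg_iff_add_eq_0)
    then have "(1 / p) *\<^sub>R p *\<^sub>R \<phi> B = (1 / p) *\<^sub>R (- r) *\<^sub>R \<phi> C" by simp
    then have k: "\<phi> B = k *\<^sub>R \<phi> C" using \<open>p \<noteq> 0\<close> by (simp add: k_def)
    consider "k < 0" | "0 \<le> k" "k \<le> 1" | "1 < k" by linarith
    then show False
    proof cases
      case 1
      have "qform (\<phi> B) x = 0" for x
      proof -
        have "k * qform (\<phi> C) x \<le> 0"
          using 1 effectsD(2)[OF image_effect[OF E(2)], of x] by (simp add: mult_le_0_iff)
        then show ?thesis
          using effectsD(2)[OF image_effect[OF E(1)], of x] by (simp add: k qform_simps)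
      qed
      then have "\<phi> B = 0" using qform_eqI[OF image_effect[OF E(1)] zero_effect] by (simp add: qform_simps)
      then show False using noB[of 0] by simp
    next
      case 2
      then show False using noB k by blast
    next
      case 3
      then have "\<phi> C = (1 / k) *\<^sub>R \<phi> B" using k by simp
      then show False using noC[of "1 / k"] 3 by simp
    qed
  qed
  show "r = 0"
  proof (rule ccontr)
    assume "r \<noteq> 0"
    then have "\<phi> C = 0" using comb p by simp
    then show False using noC[of 0] by simp
  qed
qed

text \<open>Homogeneity on rays upgrades the preservation of segments: let \<open>m\<close> be the unknown weight in the image of
  \<open>M = t B + (1 - t) C\<close>. The ray of \<open>M\<close> crosses also the segment \<open>[B, C / 2]\<close>, at \<open>x M\<close> with
  \<open>x = 1 / (2 - t)\<close>, and the ray of the image of \<open>M\<close> crosses the image of this segment at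
  \<open>1 / (2 - m)\<close> times the image of \<open>M\<close>. By homogeneity these factors agree. The argument needs
  \<open>B\<close> and \<open>C\<close> to be independent; for effects on a common ray homogeneity suffices.\<close>

lemma image_affine:
  assumes E: "B \<in> effects" "C \<in> effects" and t: "0 \<le> t" "t \<le> 1"
  shows "\<phi> (t *\<^sub>R B + (1 - t) *\<^sub>R C) = t *\<^sub>R \<phi> B + (1 - t) *\<^sub>R \<phi> C"
proof -
  have parallel: "\<phi> (s *\<^sub>R k *\<^sub>R C + (1 - s) *\<^sub>R C) = s *\<^sub>R \<phi> (k *\<^sub>R C) + (1 - s) *\<^sub>R \<phi> C"
    if C: "C \<in> effects" and k: "0 \<le> k" "k \<le> 1" and s: "0 \<le> s" "s \<le> 1" for C k s
  proof -
    have 1: "0 \<le> s * k" "s * k \<le> s" using k s by (auto intro: mult_left_le)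
    have "s *\<^sub>R k *\<^sub>R C + (1 - s) *\<^sub>R C = (s * k + (1 - s)) *\<^sub>R C" by (simp add: algebra_simps)
    moreover have "0 \<le> s * k + (1 - s)" "s * k + (1 - s) \<le> 1" using 1 s by auto
    ultimately have "\<phi> (s *\<^sub>R k *\<^sub>R C + (1 - s) *\<^sub>R C) = (s * k + (1 - s)) *\<^sub>R \<phi> C"
      using image_scaleR[OF C] by simp
    then show ?thesis using image_scaleR[OF C k] by (simp add: algebra_simps)
  qed
  consider (1) k where "0 \<le> k" "k \<le> 1" "B = k *\<^sub>R C" | (2) k where "0 \<le> k" "k \<le> 1" "C = k *\<^sub>R B"
    | (3) "\<And>k. 0 \<le> k \<Longrightarrow> k \<le> 1 \<Longrightarrow> B \<noteq> k *\<^sub>R C" "\<And>k. 0 \<le> k \<Longrightarrow> k \<le> 1 \<Longrightarrow> C \<noteq> k *\<^sub>R B"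
    by blast
  then show ?thesis
  proof cases
    case 1
    then show ?thesis using parallel[OF E(2) 1(1,2) t] by simp
  next
    case 2
    then show ?thesis using parallel[OF E(1) 2(1,2), of "1 - t"] t by (simp add: add.commute)
  next
    case 3
    define M where "M = t *\<^sub>R B + (1 - t) *\<^sub>R C"
    have ME: "M \<in> effects" unfolding M_def using E t by (rule convex_effects)
    have "mixture M B C" unfolding mixture_def M_def using t by (intro bexI[of _ t]) auto
    then obtain m where m: "\<phi> M = m *\<^sub>R \<phi> B + (1 - m) *\<^sub>R \<phi> C"
      using image_mixture[OF ME E] by (auto simp: mixture_def)
    define x where "x = 1 / (2 - t)"
    have x: "0 \<le> x" "x \<le> 1" "x * (2 - t) = 1" using t by (simp_all add: x_def)
    have xt: "0 \<le> t * x" "t * x \<le> 1" using x t by (auto intro: mult_le_one)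
    have "2 * (x * (1 - t)) = 1 - t * x" using x(3) by (simp add: algebra_simps)
    then have xM: "x *\<^sub>R M = (t * x) *\<^sub>R B + (1 - t * x) *\<^sub>R (1/2) *\<^sub>R C"
      by (simp add: M_def scaleR_add_right mult.commute)
    have CE: "(1/2) *\<^sub>R C \<in> effects" and xME: "x *\<^sub>R M \<in> effects"
      using E ME x by (auto intro: scaleR_effect)
    have "mixture (x *\<^sub>R M) B ((1/2) *\<^sub>R C)"
      unfolding mixture_def xM using xt by (intro bexI[of _ "t * x"]) auto
    then obtain s where s: "\<phi> (x *\<^sub>R M) = s *\<^sub>R \<phi> B + (1 - s) *\<^sub>R \<phi> ((1/2) *\<^sub>R C)"
      using image_mixture[OF xME E(1) CE] by (auto simp: mixture_def)
    have "x *\<^sub>R (m *\<^sub>R \<phi> B + (1 - m) *\<^sub>R \<phi> C) = s *\<^sub>R \<phi> B + (1 - s) *\<^sub>R (1/2) *\<^sub>R \<phi> C"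
      using s image_scaleR[OF ME x(1,2)] image_scaleR[OF E(2), of "1/2"] m by simp
    then have "(x * m) *\<^sub>R \<phi> B + (x * (1 - m)) *\<^sub>R \<phi> C = s *\<^sub>R \<phi> B + ((1 - s) / 2) *\<^sub>R \<phi> C"
      by (simp only: scaleR_add_right scaleR_scaleR) simp
    moreover have "(p - s) *\<^sub>R X + (q - r) *\<^sub>R Y = (p *\<^sub>R X + q *\<^sub>R Y) - (s *\<^sub>R X + r *\<^sub>R Y)"
      for p q r and X Y :: "'a \<Rightarrow>\<^sub>L 'a"
      by (simp add: algebra_simps)
    ultimately have "(x * m - s) *\<^sub>R \<phi> B + (x * (1 - m) - (1 - s) / 2) *\<^sub>R \<phi> C = 0"
      by simp
    from image_independent[OF E 3 this]
    have "x * m = s" "x * (1 - m) = (1 - s) / 2" by simp_all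
    then have "2 * (x * (1 - m)) = 1 - x * m" by simp
    then have "x * (2 - m) = x * (2 - t)" using x(3) by (simp only: right_diff_distrib)
    moreover have "x \<noteq> 0" using x(3) by auto
    ultimately have "m = t" by simp
    then show ?thesis using m M_def by simp
  qed
qed

lemma image_add_scaled:
  assumes E: "B \<in> effects" "C \<in> effects" and ab: "0 \<le> a" "0 \<le> b" "a + b \<le> 1"
  shows "\<phi> (a *\<^sub>R B + b *\<^sub>R C) = a *\<^sub>R \<phi> B + b *\<^sub>R \<phi> C"
proof (cases "a + b = 0")
  case False
  define s where "s = a + b"
  define t where "t = a / s"
  have s: "0 < s" "s \<le> 1" using False ab by (auto simp: s_def)
  have t: "0 \<le> t" "t \<le> 1" using ab s by (auto simp: t_def s_def)
  have st: "a = s * t" "b = s * (1 - t)" using s by (auto simp: t_def s_def right_diff_distrib)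
  have "a *\<^sub>R B + b *\<^sub>R C = s *\<^sub>R (t *\<^sub>R B + (1 - t) *\<^sub>R C)"
    by (simp add: st scaleR_add_right)
  moreover have "\<phi> (s *\<^sub>R (t *\<^sub>R B + (1 - t) *\<^sub>R C)) = s *\<^sub>R (t *\<^sub>R \<phi> B + (1 - t) *\<^sub>R \<phi> C)"
    using image_scaleR[OF convex_effects[OF E t], of s] s image_affine[OF E t] by simp
  ultimately show ?thesis by (simp add: st scaleR_add_right)
next
  case True
  then have "a = 0" "b = 0" using ab by auto
  then show ?thesis by (simp add: image_zero)
qed

lemma image_mono:
  assumes E: "A \<in> effects" "B \<in> effects" and le: "op_le A B"
  shows "op_le (\<phi> A) (\<phi> B)"
proof -
  have qle: "qform A x \<le> qform B x" for x using le by (simp add: op_le_def qform_def)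
  have "qform B x - qform A x \<le> (norm x)\<^sup>2" for x
    using effectsD(2)[OF E(1), of x] effectsD(3)[OF E(2), of x] by simp
  then have D: "B - A \<in> effects"
    using qle by (auto simp: effects_iff qform_simps blinfun.bilinear_simps cinner_simps effectsD(1)[OF E(1)] effectsD(1)[OF E(2)])
  have "(1/2) *\<^sub>R B = (1/2) *\<^sub>R A + (1/2) *\<^sub>R (B - A)" by (simp add: scaleR_diff_right)
  then have "\<phi> ((1/2) *\<^sub>R B) = (1/2) *\<^sub>R \<phi> A + (1/2) *\<^sub>R \<phi> (B - A)"
    using image_add_scaled[OF E(1) D, of "1/2" "1/2"] by simp
  then have "(1/2) *\<^sub>R \<phi> B = (1/2) *\<^sub>R (\<phi> A + \<phi> (B - A))"
    using image_scaleR[OF E(2), of "1/2"] by (simp add: scaleR_add_right)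
  then have "\<phi> B = \<phi> A + \<phi> (B - A)" by simp
  then have "qform (\<phi> A) x \<le> qform (\<phi> B) x" for x
    using effectsD(2)[OF image_effect[OF D], of x] by (simp add: qform_simps)
  then show ?thesis by (simp add: op_le_def qform_def)
qed

end

section \<open>Wigner's theorem\<close>

lemma cmod_add_sq: "(cmod (a + b))\<^sup>2 = (cmod a)\<^sup>2 + (cmod b)\<^sup>2 + 2 * Re (a * cnj b)"
  unfolding cmod_power2 by (simp add: power2_eq_square algebra_simps)

text \<open>The vectors on which \<open>V\<close> commutes with the imaginary unit and those on which it
  anticommutes form two additive subgroups that cover \<open>S\<close>; a group is not the union of two proper
  subgroups.\<close>

lemma real_linear_conjugation_dichotomy:
  fixes V :: "'a::complex_vector \<Rightarrow> 'b::complex_vector"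
  assumes S: "\<And>x y. x \<in> S \<Longrightarrow> y \<in> S \<Longrightarrow> x + y \<in> S" "\<And>c x. x \<in> S \<Longrightarrow> c *\<^sub>C x \<in> S"
    and add: "\<And>x y. x \<in> S \<Longrightarrow> y \<in> S \<Longrightarrow> V (x + y) = V x + V y"
    and real: "\<And>r x. x \<in> S \<Longrightarrow> V (r *\<^sub>R x) = r *\<^sub>R V x"
    and i: "\<And>x. x \<in> S \<Longrightarrow> V (\<i> *\<^sub>C x) = \<i> *\<^sub>C V x \<or> V (\<i> *\<^sub>C x) = - (\<i> *\<^sub>C V x)"
  shows "(\<forall>c. \<forall>x\<in>S. V (c *\<^sub>C x) = c *\<^sub>C V x) \<or> (\<forall>c. \<forall>x\<in>S. V (c *\<^sub>C x) = cnj c *\<^sub>C V x)"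
proof -
  have expand: "V (c *\<^sub>C x) = Re c *\<^sub>R V x + Im c *\<^sub>R V (\<i> *\<^sub>C x)" if "x \<in> S" for c x
  proof -
    have "c *\<^sub>C x = Re c *\<^sub>R x + Im c *\<^sub>R \<i> *\<^sub>C x"
      by (simp add: scaleR_scaleC scaleC_scaleC mult.commute flip: scaleC_add_left complex_eq)
    moreover have "Re c *\<^sub>R x \<in> S" "\<i> *\<^sub>C x \<in> S" "Im c *\<^sub>R \<i> *\<^sub>C x \<in> S"
      using that S(2) by (simp_all add: scaleR_scaleC)
    ultimately show ?thesis using that by (simp only: add real)
  qed
  have split: "(a + b * \<i>) *\<^sub>C v = a *\<^sub>C v + b *\<^sub>C \<i> *\<^sub>C v" for a b and v :: 'b
    by (simp add: scaleC_add_left scaleC_scaleC)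
  have "(\<forall>x\<in>S. V (\<i> *\<^sub>C x) = \<i> *\<^sub>C V x) \<or> (\<forall>x\<in>S. V (\<i> *\<^sub>C x) = - (\<i> *\<^sub>C V x))"
  proof (rule ccontr)
    assume "\<not> ?thesis"
    then obtain x y where x: "x \<in> S" "V (\<i> *\<^sub>C x) \<noteq> \<i> *\<^sub>C V x"
      and y: "y \<in> S" "V (\<i> *\<^sub>C y) \<noteq> - (\<i> *\<^sub>C V y)" by blast
    have x': "V (\<i> *\<^sub>C x) = - (\<i> *\<^sub>C V x)" and y': "V (\<i> *\<^sub>C y) = \<i> *\<^sub>C V y"
      using i x y by blast+
    have "V (\<i> *\<^sub>C (x + y)) = - (\<i> *\<^sub>C V x) + \<i> *\<^sub>C V y"
      using add[of "\<i> *\<^sub>C x" "\<i> *\<^sub>C y"] S(2) x y x' y' by (simp add: scaleC_add_right)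
    moreover have "V (\<i> *\<^sub>C (x + y)) = \<i> *\<^sub>C V x + \<i> *\<^sub>C V y \<or>
        V (\<i> *\<^sub>C (x + y)) = - (\<i> *\<^sub>C V x) - \<i> *\<^sub>C V y"
      using i[of "x + y"] S(1) x y add by (auto simp: scaleC_add_right)
    ultimately have "- (\<i> *\<^sub>C V x) = \<i> *\<^sub>C V x \<or> \<i> *\<^sub>C V y = - (\<i> *\<^sub>C V y)"
      by auto
    then show False using x x' y y' by auto
  qed
  then show ?thesis
  proof
    assume *: "\<forall>x\<in>S. V (\<i> *\<^sub>C x) = \<i> *\<^sub>C V x"
    have "V (c *\<^sub>C x) = c *\<^sub>C V x" if "x \<in> S" for c x
    proof -
      have "V (c *\<^sub>C x) = (of_real (Re c) + of_real (Im c) * \<i>) *\<^sub>C V x"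
        unfolding split using expand[OF that, of c] * that by (simp add: scaleR_scaleC)
      also have "of_real (Re c) + of_real (Im c) * \<i> = c" by (simp add: complex_eq_iff)
      finally show ?thesis .
    qed
    then show ?thesis by blast
  next
    assume *: "\<forall>x\<in>S. V (\<i> *\<^sub>C x) = - (\<i> *\<^sub>C V x)"
    have "V (c *\<^sub>C x) = cnj c *\<^sub>C V x" if "x \<in> S" for c x
    proof -
      have "V (c *\<^sub>C x) = (of_real (Re c) + of_real (- Im c) * \<i>) *\<^sub>C V x"
        unfolding split using expand[OF that, of c] * that by (simp add: scaleR_scaleC)
      also have "of_real (Re c) + of_real (- Im c) * \<i> = cnj c" by (simp add: complex_eq_iff)
      finally show ?thesis .
    qed
    then show ?thesis by blast
  qed
qed

text \<open>Fix a unit vector \<open>e\<close> with image \<open>e'\<close>. For \<open>x\<close> orthogonal to \<open>e\<close> normalise the phase of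
  \<open>f (e + x)\<close> so that its component along \<open>e'\<close> is \<open>1\<close>, and let \<open>V x\<close> be the rest. Expanding the
  preserved quantity \<open>|\<langle>e + x, z\<rangle>|\<^sup>2\<close> leaves the cross term \<open>Re (\<langle>e, z\<rangle> cnj \<langle>x, z\<rangle>)\<close>, which is real linear in
  \<open>x\<close>; since the values of \<open>f\<close> exhaust the space up to phases, \<open>V\<close> is real linear. It maps \<open>i x\<close> to \<open>i V x\<close> or
  \<open>- i V x\<close>, with one choice for all \<open>x\<close>, and extends to \<open>U\<close> by \<open>e \<mapsto> e'\<close>.\<close>

theorem wigner:
  fixes f :: "'a::complex_inner \<Rightarrow> 'a"
  assumes prob: "\<And>x y. cmod (cinner (f x) (f y)) = cmod (cinner x y)"
    and surj: "\<And>w. \<exists>z c. cmod c = 1 \<and> w = c *\<^sub>C f z"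
    and e: "norm (e :: 'a) = 1"
  shows "\<exists>U. (unitary U \<or> antiunitary U) \<and> (\<forall>x. \<exists>c. cmod c = 1 \<and> f x = c *\<^sub>C U x)"
proof -
  have nf: "norm (f x) = norm x" for x
    using prob[of x x] by (simp add: cinner_self norm_power power2_eq_iff_nonneg)
  define e' where "e' = f e"
  have e': "norm e' = 1" by (simp add: e'_def nf e)
  have ee: "cinner e e = 1" "cinner e' e' = 1" by (simp_all add: cinner_self e e')
  define S where "S = {x. cinner x e = 0}"
  have S_add: "x + y \<in> S" if "x \<in> S" "y \<in> S" for x y
    using that by (simp add: S_def cinner_simps)
  have S_scale: "c *\<^sub>C x \<in> S" if "x \<in> S" for c x
    using that by (simp add: S_def cinner_simps)
  have S_real: "r *\<^sub>R x \<in> S" if "x \<in> S" for r x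
    using that by (simp add: S_def cinner_simps)
  have "\<exists>v. cinner v e' = 0 \<and> (\<exists>c. cmod c = 1 \<and> e' + v = c *\<^sub>C f (e + x))" if x: "x \<in> S" for x
  proof -
    have "cmod (cinner (f (e + x)) e') = 1"
      using x by (simp add: e'_def prob cinner_simps S_def ee)
    moreover obtain k where k: "cmod k = 1" "k * cinner (f (e + x)) e' = of_real (cmod (cinner (f (e + x)) e'))"
      using unit_phase by blast
    ultimately have "cinner (k *\<^sub>C f (e + x) - e') e' = 0"
      by (simp add: cinner_simps ee)
    then show ?thesis using k(1) by (intro exI[of _ "k *\<^sub>C f (e + x) - e'"]) auto
  qed
  then obtain V where V_orth: "cinner (V x) e' = 0"
    and V_phase: "\<exists>c. cmod c = 1 \<and> e' + V x = c *\<^sub>C f (e + x)" if "x \<in> S" for x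
    by metis
  have V_orth': "cinner e' (V x) = 0" if "x \<in> S" for x
    using V_orth[OF that] cinner_orth_commute by blast
  have V_norm: "norm (V x) = norm x" if x: "x \<in> S" for x
  proof -
    have "cinner e x = 0" using x cinner_orth_commute by (auto simp: S_def)
    then have "(norm (e + x))\<^sup>2 = 1 + (norm x)\<^sup>2" by (simp add: norm_add_sq_cinner e)
    moreover have "(norm (e' + V x))\<^sup>2 = 1 + (norm (V x))\<^sup>2"
      using V_orth'[OF x] by (simp add: norm_add_sq_cinner e')
    moreover have "norm (e' + V x) = norm (e + x)"
      using V_phase[OF x] by (auto simp: norm_scaleC nf)
    ultimately show ?thesis by (simp add: power2_eq_iff_nonneg)
  qed
  have V_sum_prob: "cmod (cinner (e' + V x) (f z)) = cmod (cinner (e + x) z)" if x: "x \<in> S" for x z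
  proof -
    obtain c where c: "cmod c = 1" "e' + V x = c *\<^sub>C f (e + x)" using V_phase[OF x] by blast
    have "cmod (cinner (c *\<^sub>C f (e + x)) (f z)) = cmod (cinner (e + x) z)"
      by (simp only: cinner_scaleC_left norm_mult c(1) prob)
    then show ?thesis by (simp only: c(2))
  qed
  have V_f: "\<exists>c. cmod c = 1 \<and> f x = c *\<^sub>C V x" if x: "x \<in> S" for x
  proof (rule cinner_equality_case)
    have ex: "cinner e x = 0" using x cinner_orth_commute by (auto simp: S_def)
    then have "cmod (cinner e' (f x)) = 0" by (simp add: e'_def prob)
    then show "cmod (cinner (V x) (f x)) = (norm (V x))\<^sup>2"
      using V_sum_prob[OF x, of x] ex by (simp add: cinner_simps cinner_self V_norm[OF x] norm_power)
  qed (simp add: V_norm[OF x] nf)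
  have V_prob: "cmod (cinner (V x) (f z)) = cmod (cinner x z)" if x: "x \<in> S" for x z
  proof -
    obtain c where c: "cmod c = 1" "f x = c *\<^sub>C V x" using V_f[OF x] by blast
    have "cmod (cinner (f x) (f z)) = cmod (cinner (V x) (f z))"
      by (simp add: c cinner_simps norm_mult)
    then show ?thesis by (simp add: prob)
  qed
  have key: "Re (cinner e' (f z) * cnj (cinner (V x) (f z))) = Re (cinner e z * cnj (cinner x z))"
    if x: "x \<in> S" for x z
  proof -
    have "(cmod (cinner e' (f z) + cinner (V x) (f z)))\<^sup>2 = (cmod (cinner e z + cinner x z))\<^sup>2"
      using V_sum_prob[OF x, of z] by (simp add: cinner_add_left)
    then show ?thesis
      using V_prob[OF x, of z] prob[of e z] by (simp add: cmod_add_sq e'_def)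
  qed
  \<comment> \<open>A phase of the test vector cancels in the cross term, so by surjectivity every \<open>w\<close> may serve
      as one.\<close>
  have key': "\<exists>z. \<forall>x\<in>S. Re (cinner e' w * cnj (cinner (V x) w)) = Re (cinner e z * cnj (cinner x z))" for w
  proof -
    obtain z c where zc: "cmod c = 1" "w = c *\<^sub>C f z" using surj by blast
    have "cnj c * c = of_real ((cmod c)\<^sup>2)"
      by (subst mult.commute) (rule complex_norm_square[symmetric])
    then have cc: "cnj c * c = 1" unfolding zc(1) by simp
    have "cinner e' w * cnj (cinner v w) = (cnj c * c) * (cinner e' (f z) * cnj (cinner v (f z)))" for v
      unfolding zc(2) cinner_scaleC_right by simp
    then have "Re (cinner e' w * cnj (cinner (V x) w)) = Re (cinner e z * cnj (cinner x z))" if "x \<in> S" for x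
      unfolding cc mult_1 using key[OF that, of z] by (rule trans[OF arg_cong[of _ _ Re]])
    then show ?thesis by blast
  qed
  \<comment> \<open>Testing with \<open>w = e' + D\<close> isolates the norm of \<open>D\<close>.\<close>
  have determined: "D = 0"
    if D: "cinner D e' = 0" and "\<And>w. Re (cinner e' w * cnj (cinner D w)) = 0" for D
  proof -
    have D': "cinner e' D = 0" by (rule cinner_orth_commute[THEN iffD1, OF D])
    have "cinner e' (e' + D) = 1" "cinner D (e' + D) = of_real ((norm D)\<^sup>2)"
      unfolding cinner_add_right D D' ee cinner_self[of D] by simp_all
    then have "(norm D)\<^sup>2 = 0"
      using that(2)[of "e' + D"] by (simp only:) simp
    then show "D = 0" by simp
  qed
  have V_add: "V (x + y) = V x + V y" if xy: "x \<in> S" "y \<in> S" for x y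
  proof -
    have "V (x + y) - V x - V y = 0"
    proof (rule determined)
      show "cinner (V (x + y) - V x - V y) e' = 0"
        using xy S_add by (simp add: cinner_simps V_orth)
      fix w
      obtain z where z: "\<And>x. x \<in> S \<Longrightarrow> Re (cinner e' w * cnj (cinner (V x) w)) = Re (cinner e z * cnj (cinner x z))"
        using key' by blast
      show "Re (cinner e' w * cnj (cinner (V (x + y) - V x - V y) w)) = 0"
        using z[OF xy(1)] z[OF xy(2)] z[OF S_add[OF xy]]
        by (simp add: cinner_diff_left cinner_add_left right_diff_distrib distrib_left)
    qed
    then show ?thesis by (simp add: algebra_simps)
  qed
  have V_real: "V (r *\<^sub>R x) = r *\<^sub>R V x" if x: "x \<in> S" for r x
  proof -
    have "V (r *\<^sub>R x) - r *\<^sub>R V x = 0"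
    proof (rule determined)
      show "cinner (V (r *\<^sub>R x) - r *\<^sub>R V x) e' = 0"
        using x S_real by (simp add: cinner_simps V_orth)
      fix w
      obtain z where z: "\<And>x. x \<in> S \<Longrightarrow> Re (cinner e' w * cnj (cinner (V x) w)) = Re (cinner e z * cnj (cinner x z))"
        using key' by blast
      have "Re (cinner e' w * cnj (cinner (V (r *\<^sub>R x) - r *\<^sub>R V x) w)) =
          Re (cinner e' w * cnj (cinner (V (r *\<^sub>R x)) w)) - r * Re (cinner e' w * cnj (cinner (V x) w))"
        by (simp add: cinner_diff_left cinner_scaleR_left algebra_simps)
      also have "\<dots> = 0"
        unfolding z[OF x] z[OF S_real[OF x]] by (simp add: cinner_scaleR_left algebra_simps)
      finally show "Re (cinner e' w * cnj (cinner (V (r *\<^sub>R x) - r *\<^sub>R V x) w)) = 0" .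
    qed
    then show ?thesis by simp
  qed
  have V_i: "V (\<i> *\<^sub>C x) = \<i> *\<^sub>C V x \<or> V (\<i> *\<^sub>C x) = - (\<i> *\<^sub>C V x)" if x: "x \<in> S" for x
  proof (cases "x = 0")
    case True
    have "V 0 = 0" using V_norm[of 0] by (simp add: S_def)
    then show ?thesis using True by simp
  next
    case False
    have ix: "\<i> *\<^sub>C x \<in> S" by (rule S_scale[OF x])
    \<comment> \<open>\<open>V (i x)\<close> is a multiple \<open>k V x\<close> with \<open>|k| = 1\<close>, and comparing the norms of \<open>x + i x\<close> and
        its image gives \<open>|1 + k| = |1 + i|\<close>.\<close>
    obtain c where c: "cmod c = 1" "f x = c *\<^sub>C V x" using V_f[OF x] by blast
    have "cmod (cinner (V (\<i> *\<^sub>C x)) (V x)) = cmod (cinner (V (\<i> *\<^sub>C x)) (f x))"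
      by (simp add: c cinner_simps norm_mult)
    also have "\<dots> = (norm x)\<^sup>2"
      by (simp add: V_prob[OF ix] cinner_simps cinner_self norm_mult norm_power)
    finally have "cmod (cinner (V x) (V (\<i> *\<^sub>C x))) = (norm (V x))\<^sup>2"
      by (simp only: cmod_cinner_commute[of "V x" "V (\<i> *\<^sub>C x)"] V_norm[OF x])
    moreover have "norm (V x) = norm (V (\<i> *\<^sub>C x))"
      by (simp add: V_norm[OF x] V_norm[OF ix] norm_scaleC)
    ultimately obtain k where k: "cmod k = 1" "V (\<i> *\<^sub>C x) = k *\<^sub>C V x"
      using cinner_equality_case by blast
    have "norm (V (x + \<i> *\<^sub>C x)) = norm (x + \<i> *\<^sub>C x)"
      using V_norm S_add[OF x ix] by simp
    moreover have "V (x + \<i> *\<^sub>C x) = (1 + k) *\<^sub>C V x"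
      by (simp add: V_add[OF x ix] k scaleC_add_left scaleC_one)
    moreover have "x + \<i> *\<^sub>C x = (1 + \<i>) *\<^sub>C x" by (simp add: scaleC_add_left scaleC_one)
    ultimately have "cmod (1 + k) = cmod (1 + \<i>)"
      using False by (simp add: norm_scaleC V_norm[OF x])
    then have "(cmod (1 + k))\<^sup>2 = (cmod (1 + \<i>))\<^sup>2" by simp
    then have Re: "Re k = 0" using k(1) by (simp add: cmod_add_sq)
    have "(Re k)\<^sup>2 + (Im k)\<^sup>2 = 1" unfolding cmod_power2[symmetric] k(1) by simp
    then have "Im k = 1 \<or> Im k = - 1" by (simp add: Re power2_eq_1_iff)
    then have "k = \<i> \<or> k = - \<i>" by (simp add: complex_eq_iff Re)
    then show ?thesis using k(2) by auto
  qed
  have "\<exists>\<sigma>. (\<sigma> = (\<lambda>c. c) \<or> \<sigma> = cnj) \<and> (\<forall>c. \<forall>x\<in>S. V (c *\<^sub>C x) = \<sigma> c *\<^sub>C V x)"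
  proof -
    have "(\<forall>c. \<forall>x\<in>S. V (c *\<^sub>C x) = c *\<^sub>C V x) \<or> (\<forall>c. \<forall>x\<in>S. V (c *\<^sub>C x) = cnj c *\<^sub>C V x)"
      by (rule real_linear_conjugation_dichotomy[of S V, OF S_add S_scale V_add V_real V_i])
    then show ?thesis
      by (elim disjE) (rule exI[of _ "\<lambda>c. c"] exI[of _ cnj]; simp)+
  qed
  \<comment> \<open>With \<open>\<sigma>\<close> the identity or the conjugation, the unitary and the antiunitary case share one
      construction.\<close>
  then obtain \<sigma> where \<sigma>: "\<sigma> = (\<lambda>c. c) \<or> \<sigma> = cnj"
    and V_\<sigma>: "\<And>c x. x \<in> S \<Longrightarrow> V (c *\<^sub>C x) = \<sigma> c *\<^sub>C V x"
    by blast
  have \<sigma>_simps: "\<sigma> (a + b) = \<sigma> a + \<sigma> b" "\<sigma> (a * b) = \<sigma> a * \<sigma> b" "cmod (\<sigma> a) = cmod a"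
    "cnj (\<sigma> a) = \<sigma> (cnj a)" "\<sigma> (\<sigma> a) = a" for a b
    using \<sigma> by auto
  define U where "U z = \<sigma> (cinner z e) *\<^sub>C e' + V (z - cinner z e *\<^sub>C e)" for z
  have proj: "z - cinner z e *\<^sub>C e \<in> S" for z
    by (simp add: S_def cinner_simps ee)
  have U_add: "U (y + z) = U y + U z" for y z
  proof -
    have eq: "y + z - cinner (y + z) e *\<^sub>C e = (y - cinner y e *\<^sub>C e) + (z - cinner z e *\<^sub>C e)"
      by (simp add: cinner_simps scaleC_add_left)
    show ?thesis
      unfolding U_def eq V_add[OF proj proj] by (simp add: cinner_simps \<sigma>_simps scaleC_add_left)
  qed
  have U_scale: "U (c *\<^sub>C z) = \<sigma> c *\<^sub>C U z" for c z
  proof -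
    have eq: "c *\<^sub>C z - cinner (c *\<^sub>C z) e *\<^sub>C e = c *\<^sub>C (z - cinner z e *\<^sub>C e)"
      by (simp add: cinner_simps complex_vector.scale_right_diff_distrib scaleC_scaleC)
    show ?thesis
      unfolding U_def eq V_\<sigma>[OF proj] by (simp add: cinner_simps \<sigma>_simps scaleC_add_right scaleC_scaleC)
  qed
  have U_norm: "norm (U z) = norm z" for z
  proof -
    define c x where "c = cinner z e" and "x = z - cinner z e *\<^sub>C e"
    have x: "x \<in> S" "cinner e x = 0"
      using proj[of z] cinner_orth_commute by (auto simp: x_def S_def)
    have "U z = \<sigma> c *\<^sub>C e' + V x" by (simp add: U_def c_def x_def)
    then have "(norm (U z))\<^sup>2 = (cmod c)\<^sup>2 + (norm x)\<^sup>2"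
      using V_orth'[OF x(1)]
      by (simp add: norm_add_sq_cinner norm_scaleC e' V_norm[OF x(1)] cinner_scaleC_left \<sigma>_simps)
    moreover have "z = c *\<^sub>C e + x" by (simp add: c_def x_def)
    then have "(norm z)\<^sup>2 = (cmod c)\<^sup>2 + (norm x)\<^sup>2"
      using x(2) by (simp add: norm_add_sq_cinner norm_scaleC e cinner_simps)
    ultimately have "(norm (U z))\<^sup>2 = (norm z)\<^sup>2" by simp
    then show ?thesis by (simp add: power2_eq_iff_nonneg)
  qed
  have U_prob: "cmod (cinner (U z) (f y)) = cmod (cinner z y)" for z y
  proof -
    define c x where "c = cinner z e" and "x = z - cinner z e *\<^sub>C e"
    have x: "x \<in> S" using proj[of z] by (simp add: x_def)
    have z: "z = c *\<^sub>C e + x" by (simp add: c_def x_def)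
    have "cnj (cinner (V (cnj c *\<^sub>C x)) (f y)) = \<sigma> c * cnj (cinner (V x) (f y))"
      by (simp add: V_\<sigma>[OF x] cinner_simps \<sigma>_simps)
    then have cross: "Re (\<sigma> c * cinner e' (f y) * cnj (cinner (V x) (f y))) = Re (c * cinner e y * cnj (cinner x y))"
      using key[OF S_scale[OF x, of "cnj c"], of y] by (simp add: cinner_simps mult.commute mult.left_commute)
    have "cinner (U z) (f y) = \<sigma> c * cinner e' (f y) + cinner (V x) (f y)"
      by (simp only: U_def cinner_add_left cinner_scaleC_left c_def x_def)
    then have "(cmod (cinner (U z) (f y)))\<^sup>2 = (cmod (c * cinner e y + cinner x y))\<^sup>2"
      using V_prob[OF x, of y] prob[of e y] cross
      by (simp add: cmod_add_sq norm_mult \<sigma>_simps e'_def)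
    also have "c * cinner e y + cinner x y = cinner z y" by (simp add: z cinner_simps)
    finally show ?thesis by (simp add: power2_eq_iff_nonneg)
  qed
  have U_f: "\<exists>c. cmod c = 1 \<and> f z = c *\<^sub>C U z" for z
    using U_prob[of z z] by (intro cinner_equality_case) (simp_all add: U_norm nf cinner_self norm_power)
  have "surj U"
  proof (rule surjI)
    fix w
    show "U (SOME z. U z = w) = w"
    proof (rule someI_ex)
      obtain z c where "cmod c = 1" "w = c *\<^sub>C f z" using surj by blast
      moreover obtain k where "f z = k *\<^sub>C U z" using U_f by blast
      ultimately have "U (\<sigma> (c * k) *\<^sub>C z) = w" by (simp add: U_scale \<sigma>_simps scaleC_scaleC)
      then show "\<exists>z. U z = w" by blast
    qed
  qed
  then have "unitary U \<or> antiunitary U"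
    using \<sigma> U_scale U_add U_norm
    by (auto simp: unitary_def antiunitary_def Vector_Spaces.linear_iff complex_vector.vector_space_axioms)
  then show ?thesis using U_f by blast
qed

section \<open>Rank-one projections\<close>

text \<open>Minimality among the nonzero projections characterises the rank-one projections in terms that an
  order automorphism preserves.\<close>

definition minimal_projection :: "('a::complex_inner \<Rightarrow>\<^sub>L 'a) \<Rightarrow> bool" where
  "minimal_projection A \<longleftrightarrow> extreme_effect A \<and> A \<noteq> 0 \<and>
     (\<forall>Q. extreme_effect Q \<longrightarrow> op_le Q A \<longrightarrow> Q = 0 \<or> Q = A)"

lemma op_le_iff_qform: "op_le A B \<longleftrightarrow> (\<forall>x. qform A x \<le> qform B x)"
  by (simp add: op_le_def qform_def)

lemma rank1_self: "norm v = 1 \<Longrightarrow> rank1 v v = v"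
  by (simp add: rank1.rep_eq cinner_self scaleC_one)

lemma rank1_nonzero: "norm v = 1 \<Longrightarrow> rank1 v \<noteq> 0"
  using rank1_self[of v] by fastforce

lemma rank1_minimal:
  assumes v: "norm v = 1"
  shows "minimal_projection (rank1 v)"
  unfolding minimal_projection_def
proof (intro conjI allI impI rank1_extreme[OF v] rank1_nonzero[OF v])
  fix Q assume Q: "extreme_effect Q" and le: "op_le Q (rank1 v)"
  have QE: "Q \<in> effects" using Q by (simp add: extreme_effect_def)
  have vv: "cinner v v = 1" using v by (simp add: cinner_self)
  have orth: "Q z = 0" if "cinner z v = 0" for z
  proof -
    have "qform Q z \<le> 0"
      using le[unfolded op_le_iff_qform, rule_format, of z] that by (simp add: qform_rank1)
    then show ?thesis using effectsD(2)[OF QE, of z] qform_eq_0D[OF QE] by fastforce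
  qed
  define q where "q = cinner (Q v) v"
  define w where "w = Q v - q *\<^sub>C v"
  have wv: "cinner w v = 0" by (simp add: w_def q_def cinner_simps vv)
  have "cinner (Q v) w = 0" using orth[OF wv] by (simp add: effectsD(1)[OF QE])
  moreover have "cinner v w = 0" using wv cinner_orth_commute by blast
  ultimately have "cinner w w = 0" by (simp add: w_def[THEN arg_cong, of "\<lambda>u. cinner u w"] cinner_simps)
  then have "w = 0" by (simp add: cinner_eq_zero_iff)
  then have Qv: "Q v = q *\<^sub>C v" by (simp add: w_def)
  have "Q (Q v) = (q * q) *\<^sub>C v" by (simp add: Qv effects_scaleC[OF QE] scaleC_scaleC)
  then have "(q * q) *\<^sub>C v = q *\<^sub>C v" using extreme_effect_idem[OF Q, of v] Qv by simp
  then have q: "q = 0 \<or> q = 1" using v by auto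
  have "Q z = (q * cinner z v) *\<^sub>C v" for z
  proof -
    have "Q (z - cinner z v *\<^sub>C v) = 0" by (rule orth) (simp add: cinner_simps vv)
    then show ?thesis by (simp add: blinfun.diff_right effects_scaleC[OF QE] Qv scaleC_scaleC mult.commute)
  qed
  then show "Q = 0 \<or> Q = rank1 v"
    using q by (auto intro!: blinfun_eqI simp: rank1.rep_eq)
qed

lemma minimal_projection_rank1:
  assumes A: "minimal_projection A"
  obtains v where "norm v = 1" "A = rank1 v"
proof -
  have ext: "extreme_effect A" and "A \<noteq> 0" using A by (auto simp: minimal_projection_def)
  have AE: "A \<in> effects" using ext by (simp add: extreme_effect_def)
  obtain y where y: "A y \<noteq> 0" using \<open>A \<noteq> 0\<close> by (metis blinfun_eqI zero_blinfun.rep_eq)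
  define v where "v = (1 / norm (A y)) *\<^sub>R A y"
  have v: "norm v = 1" "A v = v"
    using y by (simp_all add: v_def blinfun.scaleR_right extreme_effect_idem[OF ext])
  have "qform (rank1 v) z \<le> qform A z" for z
  proof -
    have "cmod (cinner z v) = cmod (cinner (A z) v)" by (simp add: effectsD(1)[OF AE] v)
    also have "\<dots> \<le> norm (A z)" using Cauchy_Schwarz[of "A z" v] v by simp
    finally have "(cmod (cinner z v))\<^sup>2 \<le> (norm (A z))\<^sup>2" by (rule power_mono) simp
    also have "\<dots> \<le> qform A z" by (rule norm_effect_le[OF AE])
    finally show ?thesis unfolding qform_rank1 .
  qed
  then have "rank1 v = 0 \<or> rank1 v = A"
    using A rank1_extreme[OF v(1)] by (simp add: minimal_projection_def op_le_iff_qform)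
  then have "A = rank1 v" using rank1_nonzero[OF v(1)] by blast
  then show ?thesis using v(1) that by blast
qed

lemma rank1_eq_phase:
  assumes "norm v = 1" "norm w = 1" "rank1 v = rank1 w"
  shows "\<exists>c. cmod c = 1 \<and> w = c *\<^sub>C v"
proof (rule cinner_equality_case)
  have "qform (rank1 v) v = qform (rank1 w) v" by (simp only: assms(3))
  then show "cmod (cinner v w) = (norm v)\<^sup>2"
    using assms(1) by (simp add: qform_rank1 cinner_self power2_eq_1_iff)
      (metis norm_ge_zero one_neq_neg_one not_one_le_zero abs_norm_cancel abs_1 abs_minus_cancel)
qed (use assms in simp)

text \<open>An off-diagonal block of a positive operator is controlled by the diagonal ones: split \<open>z\<close> into \<open>u\<close> along
  \<open>x\<close> and \<open>w\<close> orthogonal to it, and bound the cross term using that the form is nonnegative at \<open>\<epsilon> u - w\<close>.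
  The upper bound involves only \<open>\<langle>A x, x\<rangle>\<close>, the projection on \<open>x\<close> and the identity.\<close>

lemma effect_le_block_diagonal:
  assumes A: "A \<in> effects" and x: "norm x = 1" and \<epsilon>: "0 < \<epsilon>"
  shows "qform A z \<le> (1 + \<epsilon>) * qform A x * qform (rank1 x) z
    + (1 + 1 / \<epsilon>) * qform (id_blinfun - rank1 x) z"
proof -
  define c where "c = cinner z x"
  define u where "u = c *\<^sub>C x"
  define w where "w = z - u"
  have xx: "cinner x x = 1" using x by (simp add: cinner_self)
  have u: "qform A u = (cmod c)\<^sup>2 * qform A x"
  proof -
    have "cinner (A u) u = (c * cnj c) * cinner (A x) x"
      by (simp add: u_def effects_scaleC[OF A] cinner_simps)
    then have "cinner (A u) u = of_real ((cmod c)\<^sup>2) * cinner (A x) x"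
      by (simp only: complex_norm_square)
    then show ?thesis by (simp add: qform_def)
  qed
  have "qform (id_blinfun - rank1 x) z = (norm w)\<^sup>2"
  proof -
    have "cinner z u = of_real ((cmod c)\<^sup>2)"
      by (simp only: u_def cinner_scaleC_right complex_norm_square c_def[symmetric] mult.commute)
    then have "Re (cinner z u) = (cmod c)\<^sup>2" by simp
    then show ?thesis
      by (simp add: w_def norm_diff_sq_cinner qform_simps qform_rank1 flip: c_def)
        (simp add: u_def norm_scaleC x)
  qed
  then have w: "qform A w \<le> qform (id_blinfun - rank1 x) z"
    using effectsD(3)[OF A, of w] by simp
  have "0 \<le> qform A (\<epsilon> *\<^sub>R u - w)" by (rule effectsD(2)[OF A])
  also have "\<dots> = \<epsilon>\<^sup>2 * qform A u + qform A w - 2 * (\<epsilon> * Re (cinner (A u) w))"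
    by (simp add: qform_diff[OF A] qform_scaleR blinfun.scaleR_right cinner_simps)
  finally have "\<epsilon> * (2 * Re (cinner (A u) w)) \<le> \<epsilon> * (\<epsilon> * qform A u + qform A w / \<epsilon>)"
    using \<epsilon> by (simp add: algebra_simps power2_eq_square)
  then have cross: "2 * Re (cinner (A u) w) \<le> \<epsilon> * qform A u + qform A w / \<epsilon>"
    using \<epsilon> by simp
  have "qform A z = qform A u + qform A w + 2 * Re (cinner (A u) w)"
    using qform_add[OF A, of u w] by (simp add: w_def)
  also have "\<dots> \<le> (1 + \<epsilon>) * qform A u + (1 + 1 / \<epsilon>) * qform A w"
    using cross by (simp add: algebra_simps)
  also have "\<dots> \<le> (1 + \<epsilon>) * qform A u + (1 + 1 / \<epsilon>) * qform (id_blinfun - rank1 x) z"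
    using w \<epsilon> by (intro add_left_mono mult_left_mono) auto
  finally show ?thesis by (simp add: u qform_rank1 mult.assoc mult.left_commute mult.commute flip: c_def)
qed

context unital_mixture_automorphism
begin

interpretation inv: unital_mixture_automorphism "inv_into effects \<phi>"
  by (rule inverse)

lemma minimal_projection_image:
  assumes P: "minimal_projection P"
  shows "minimal_projection (\<phi> P)"
proof -
  have ext: "extreme_effect P" and "P \<noteq> 0" using P by (auto simp: minimal_projection_def)
  have PE: "P \<in> effects" using ext by (simp add: extreme_effect_def)
  have "\<phi> P \<noteq> 0" using image_eq_iff[OF PE zero_effect] \<open>P \<noteq> 0\<close> image_zero by simp
  moreover have "Q = 0 \<or> Q = \<phi> P" if Q: "extreme_effect Q" "op_le Q (\<phi> P)" for Q
  proof -
    have QE: "Q \<in> effects" using Q by (simp add: extreme_effect_def)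
    have "op_le (inv_into effects \<phi> Q) P"
      using inv.image_mono[OF QE image_effect[OF PE] Q(2)] inv_image(1)[OF PE] by simp
    moreover have "extreme_effect (inv_into effects \<phi> Q)"
      by (rule extreme_effect_image[OF inv.automorphism Q(1)])
    ultimately have "inv_into effects \<phi> Q = 0 \<or> inv_into effects \<phi> Q = P"
      using P by (auto simp: minimal_projection_def)
    then show ?thesis using inv_image(2)[OF QE] image_zero by auto
  qed
  ultimately show ?thesis
    using extreme_effect_image[OF automorphism ext] by (simp add: minimal_projection_def)
qed

lemma rank1_image:
  assumes "norm v = 1"
  obtains w where "norm w = 1" "\<phi> (rank1 v) = rank1 w"
  using minimal_projection_rank1[OF minimal_projection_image[OF rank1_minimal[OF assms]]] by metis

text \<open>By \<open>effect_le_block_diagonal\<close> the effect \<open>A\<close> lies below a combination of the projection on \<open>x\<close> and its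
  complement with coefficient \<open>(1 + \<epsilon>) \<langle>A x, x\<rangle>\<close> at the former. The image of this
  combination is known, and evaluating the preserved inequality at \<open>x'\<close> bounds the form there.\<close>

lemma qform_image_le:
  assumes A: "A \<in> effects" and x: "norm x = 1" and x': "norm x' = 1"
    and im: "\<phi> (rank1 x) = rank1 x'"
  shows "qform (\<phi> A) x' \<le> qform A x"
proof (rule field_le_epsilon)
  fix \<epsilon> :: real assume \<epsilon>: "0 < \<epsilon>"
  define a where "a = qform A x"
  have a: "0 \<le> a" "a \<le> 1" using effectsD(2,3)[OF A, of x] x by (simp_all add: a_def)
  \<comment> \<open>Division by \<open>K\<close> turns both sides of the inequality into effects.\<close>
  define K where "K = (1 + \<epsilon>) + (1 + 1 / \<epsilon>)"
  have K: "1 \<le> K" using \<epsilon> by (simp add: K_def)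
  define \<alpha> \<beta> where "\<alpha> = (1 + \<epsilon>) * a / K" and "\<beta> = (1 + 1 / \<epsilon>) / K"
  have \<alpha>\<beta>: "0 \<le> \<alpha>" "0 \<le> \<beta>" using K a \<epsilon> by (simp_all add: \<alpha>_def \<beta>_def)
  have "\<alpha> + \<beta> = ((1 + \<epsilon>) * a + (1 + 1 / \<epsilon>)) / K"
    by (simp add: \<alpha>_def \<beta>_def add_divide_distrib)
  moreover have "(1 + \<epsilon>) * a \<le> 1 + \<epsilon>" using a \<epsilon> by (simp add: mult_left_le)
  then have "(1 + \<epsilon>) * a + (1 + 1 / \<epsilon>) \<le> K" by (simp add: K_def)
  ultimately have sum: "\<alpha> + \<beta> \<le> 1" using K by simp
  define P where "P = rank1 x"
  have PE: "P \<in> effects" "id_blinfun - P \<in> effects" using rank1_effect[OF x] by (auto simp: P_def)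
  define C where "C = \<alpha> *\<^sub>R P + \<beta> *\<^sub>R (id_blinfun - P)"
  have KE: "(1 / K) *\<^sub>R A \<in> effects" using K A by (intro scaleR_effect) auto
  have CE: "C \<in> effects"
  proof -
    have "C = plane_point P (\<alpha>, \<beta>)" by (simp add: C_def plane_point_def)
    then show ?thesis
      using plane_point_effect[OF PE(1)] \<alpha>\<beta> sum by (simp add: unit_square_def)
  qed
  have "op_le ((1 / K) *\<^sub>R A) C"
    unfolding op_le_iff_qform
  proof
    fix z
    have "qform A z \<le> (1 + \<epsilon>) * a * qform P z + (1 + 1 / \<epsilon>) * qform (id_blinfun - P) z"
      unfolding a_def P_def by (rule effect_le_block_diagonal[OF A x \<epsilon>])
    then have "qform A z / K \<le> ((1 + \<epsilon>) * a * qform P z + (1 + 1 / \<epsilon>) * qform (id_blinfun - P) z) / K"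
      using K by (intro divide_right_mono) auto
    moreover have "\<alpha> * X + \<beta> * Y = ((1 + \<epsilon>) * a * X + (1 + 1 / \<epsilon>) * Y) / K" for X Y
      unfolding \<alpha>_def \<beta>_def times_divide_eq_left add_divide_distrib[symmetric] ..
    ultimately show "qform ((1 / K) *\<^sub>R A) z \<le> qform C z"
      by (simp only: C_def qform_simps(1,3)) simp
  qed
  then have "op_le (\<phi> ((1 / K) *\<^sub>R A)) (\<phi> C)" by (rule image_mono[OF KE CE])
  moreover have "\<phi> ((1 / K) *\<^sub>R A) = (1 / K) *\<^sub>R \<phi> A"
    using K by (intro image_scaleR[OF A]) auto
  moreover have "\<phi> C = \<alpha> *\<^sub>R rank1 x' + \<beta> *\<^sub>R (id_blinfun - rank1 x')"
    unfolding C_def image_add_scaled[OF PE \<alpha>\<beta> sum] image_compl[OF PE(1)]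
    by (simp add: P_def im)
  ultimately have "(1 / K) * qform (\<phi> A) x' \<le> \<alpha>"
    using x' by (simp add: op_le_iff_qform qform_simps qform_rank1 cinner_self)
      (drule spec[of _ x'], simp add: cinner_self)
  then have "qform (\<phi> A) x' \<le> (1 + \<epsilon>) * a"
    using K by (simp add: \<alpha>_def divide_le_cancel)
  also have "\<dots> \<le> a + \<epsilon>" using a \<epsilon> by (simp add: algebra_simps mult_left_le)
  finally show "qform (\<phi> A) x' \<le> qform A x + \<epsilon>" by (simp add: a_def)
qed

text \<open>The reverse inequality is the one for \<open>I - A\<close>.\<close>

lemma qform_image:
  assumes A: "A \<in> effects" and x: "norm x = 1" "norm x' = 1" and im: "\<phi> (rank1 x) = rank1 x'"
  shows "qform (\<phi> A) x' = qform A x"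
  using qform_image_le[OF A x im] qform_image_le[OF _ x im, of "id_blinfun - A"] A x
  by (simp add: image_compl qform_simps)

end

context unital_mixture_automorphism
begin

interpretation inv: unital_mixture_automorphism "inv_into effects \<phi>"
  by (rule inverse)

text \<open>Choosing representatives of the images of rank-one projections gives a map of vectors to which
  Wigner's theorem applies, with \<open>qform_image\<close> for \<open>A\<close> of rank one as the required preservation of
  transition probabilities. The same lemma then identifies the image of every effect.\<close>

theorem unitarily_implemented:
  "\<exists>U. (unitary U \<or> antiunitary U) \<and> (\<forall>A\<in>effects. blinfun_apply (\<phi> A) = U \<circ> blinfun_apply A \<circ> inv U)"
proof -
  define g where "g v = (SOME w. norm w = 1 \<and> \<phi> (rank1 v) = rank1 w)" for v
  have g: "norm (g v) = 1" "\<phi> (rank1 v) = rank1 (g v)" if "norm v = 1" for v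
  proof -
    have "\<exists>w. norm w = 1 \<and> \<phi> (rank1 v) = rank1 w" using rank1_image[OF that] by metis
    from someI_ex[OF this] show "norm (g v) = 1" "\<phi> (rank1 v) = rank1 (g v)" by (simp_all add: g_def)
  qed
  have g_prob: "cmod (cinner (g u) (g v)) = cmod (cinner u v)" if "norm u = 1" "norm v = 1" for u v
    using qform_image[OF rank1_effect[OF that(2)] that(1) g(1)[OF that(1)] g(2)[OF that(1)]]
    by (simp add: g(2)[OF that(2)] qform_rank1 power2_eq_iff_nonneg)
  define unit where "unit x = (1 / norm x) *\<^sub>R x" for x :: 'a
  have unit: "norm (unit x) = 1" "x = norm x *\<^sub>R unit x" if "x \<noteq> 0" for x
    using that by (simp_all add: unit_def)
  define f where "f x = norm x *\<^sub>R g (unit x)" for x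
  have f_prob: "cmod (cinner (f x) (f y)) = cmod (cinner x y)" for x y
  proof (cases "x = 0 \<or> y = 0")
    case False
    have "cmod (cinner (f x) (f y)) = norm x * (norm y * cmod (cinner (unit x) (unit y)))"
      using g_prob[of "unit x" "unit y"] unit False by (simp add: f_def cinner_simps norm_mult)
    also have "\<dots> = cmod (cinner (norm x *\<^sub>R unit x) (norm y *\<^sub>R unit y))"
      by (simp add: cinner_simps norm_mult)
    finally show ?thesis using unit(2)[of x] unit(2)[of y] False by simp
  qed (auto simp: f_def)
  have f_surj: "\<exists>z c. cmod c = 1 \<and> w = c *\<^sub>C f z" for w
  proof (cases "w = 0")
    case True
    then show ?thesis by (intro exI[of _ 0] exI[of _ 1]) (simp add: f_def)
  next
    case False
    obtain u where u: "norm u = 1" "inv_into effects \<phi> (rank1 (unit w)) = rank1 u"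
      using inv.rank1_image[OF unit(1)[OF False]] by metis
    have "rank1 (unit w) = \<phi> (rank1 u)"
      using inv_image(2)[OF rank1_effect[OF unit(1)[OF False]]] u(2) by simp
    then have "rank1 (g u) = rank1 (unit w)" using g(2)[OF u(1)] by simp
    then obtain c where c: "cmod c = 1" "unit w = c *\<^sub>C g u"
      using rank1_eq_phase[OF g(1)[OF u(1)] unit(1)[OF False]] by blast
    have "unit (norm w *\<^sub>R u) = u" using u(1) False by (simp add: unit_def)
    then have "f (norm w *\<^sub>R u) = norm w *\<^sub>R g u"
      using u(1) by (simp add: f_def)
    then have "c *\<^sub>C f (norm w *\<^sub>R u) = norm w *\<^sub>R unit w"
      by (simp add: c(2) scaleR_scaleC scaleC_scaleC mult.commute)
    then have "w = c *\<^sub>C f (norm w *\<^sub>R u)" using unit(2)[OF False] by simp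
    then show ?thesis using c(1) by blast
  qed
  obtain A :: "'a \<Rightarrow>\<^sub>L 'a" where "\<not> scalar_op A" using nonscalar_exists by blast
  then have "A \<noteq> 0" by auto
  then obtain y where "A y \<noteq> 0" by (metis blinfun_eqI zero_blinfun.rep_eq)
  then have "y \<noteq> 0" by auto
  obtain U where U: "unitary U \<or> antiunitary U" and fU: "\<And>x. \<exists>c. cmod c = 1 \<and> f x = c *\<^sub>C U x"
    using wigner[OF f_prob f_surj unit(1)[OF \<open>y \<noteq> 0\<close>]] by blast
  have U_add: "U (x + y) = U x + U y" and U_norm: "norm (U x) = norm x" and U_surj: "surj U" for x y
    using U by (auto simp: unitary_def antiunitary_def Vector_Spaces.linear_iff)
  have U_scale: "U (r *\<^sub>R x) = r *\<^sub>R U x" for r x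
    using U by (auto simp: unitary_def antiunitary_def Vector_Spaces.linear_iff scaleR_scaleC)
  have U_Re: "Re (cinner (U x) (U y)) = Re (cinner x y)" for x y
    by (rule Re_cinner_isometry[OF U_add U_norm])
  have qU: "qform (\<phi> A) (U x) = qform A x" if A: "A \<in> effects" for A x
  proof (cases "x = 0")
    case True
    then have "U x = 0" using U_norm[of 0] by simp
    then show ?thesis using True by (simp add: qform_def)
  next
    case False
    note u = unit[OF False]
    have "unit (unit x) = unit x" using u(1) by (simp add: unit_def[of "unit x"])
    then have "f (unit x) = g (unit x)" using u(1) by (simp add: f_def)
    then obtain c where c: "cmod c = 1" "g (unit x) = c *\<^sub>C U (unit x)" using fU by metis
    then have "\<phi> (rank1 (unit x)) = rank1 (U (unit x))"
      using g(2)[OF u(1)] rank1_phase by metis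
    then have "qform (\<phi> A) (U (unit x)) = qform A (unit x)"
      using qform_image[OF A u(1)] U_norm u(1) by simp
    then have "qform (\<phi> A) (norm x *\<^sub>R U (unit x)) = qform A (norm x *\<^sub>R unit x)"
      by (simp add: qform_scaleR)
    then show ?thesis using u(2) U_scale by metis
  qed
  have intertwine: "\<phi> A (U x) = U (A x)" if A: "A \<in> effects" for A x
  proof -
    have "Re (cinner (\<phi> A (U x)) (U y)) = Re (cinner (U (A x)) (U y))" for y
      using qform_add[OF image_effect[OF A], of "U x" "U y"] qform_add[OF A, of x y]
      by (simp add: qU[OF A] U_Re flip: U_add)
    moreover obtain y where "U y = \<phi> A (U x) - U (A x)" using U_surj by (metis surjD)
    ultimately have "Re (cinner (\<phi> A (U x) - U (A x)) (\<phi> A (U x) - U (A x))) = 0"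
      by (metis cinner_diff_left diff_self minus_complex.sel(1))
    then show ?thesis by (simp add: Re_cinner_self)
  qed
  have "blinfun_apply (\<phi> A) = U \<circ> blinfun_apply A \<circ> inv U" if "A \<in> effects" for A
  proof
    fix y
    show "\<phi> A y = (U \<circ> blinfun_apply A \<circ> inv U) y"
      using intertwine[OF that, of "inv U y"] by (simp add: surj_f_inv_f[OF U_surj])
  qed
  then show ?thesis using U by blast
qed

end

lemma nonscalar_effect_exists:
  assumes "complex_dim_ge TYPE('a::complex_inner) 2"
  shows "\<exists>A::'a \<Rightarrow>\<^sub>L 'a. A \<in> effects \<and> \<not> scalar_op A"
proof -
  obtain B :: "'a set" where "card B = 2" and ind: "complex_vector.independent B"
    using assms by (auto simp: complex_dim_ge_def)
  then obtain a b where B: "B = {a, b}" "a \<noteq> b" by (meson card_2_iff)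
  have b: "b \<notin> complex_vector.span {a}"
    using ind B by (auto simp: complex_vector.dependent_def insert_Diff_if)
  have "a \<noteq> 0" using ind B complex_vector.dependent_zero by blast
  define e where "e = (1 / norm a) *\<^sub>R a"
  have e: "norm e = 1" using \<open>a \<noteq> 0\<close> by (simp add: e_def)
  have "\<not> scalar_op (rank1 e)"
  proof
    assume "scalar_op (rank1 e)"
    then obtain c where c: "rank1 e = c *\<^sub>R id_blinfun" by (auto simp: scalar_op_def)
    then have "c *\<^sub>R e = e" using rank1_self[OF e] by (simp add: blinfun.bilinear_simps)
    then have "(c - 1) *\<^sub>R e = 0" by (simp add: scaleR_diff_left)
    then have "c = 1" using e by auto
    then have "b = cinner b e *\<^sub>C e"
      using arg_cong[OF c, of "\<lambda>A. blinfun_apply A b"] by (simp add: rank1.rep_eq)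
    also have "\<dots> = (cinner b e * of_real (1 / norm a)) *\<^sub>C a"
      by (simp only: e_def[THEN arg_cong, of "\<lambda>u. cinner b e *\<^sub>C u"] scaleR_scaleC scaleC_scaleC)
    finally have "b \<in> complex_vector.span {a}"
      by (metis complex_vector.span_base complex_vector.span_scale singletonI)
    then show False using b by contradiction
  qed
  then show ?thesis using rank1_effect[OF e] by blast
qed

theorem theorem3:
  fixes \<phi> :: "('a::chilbert_space \<Rightarrow>\<^sub>L 'a) \<Rightarrow> ('a \<Rightarrow>\<^sub>L 'a)"
  assumes "complex_dim_ge TYPE('a) 2"
    and "bij_betw \<phi> effects effects"
    and "\<And>A B C. A \<in> effects \<Longrightarrow> B \<in> effects \<Longrightarrow> C \<in> effects \<Longrightarrow>
           mixture A B C \<longleftrightarrow> mixture (\<phi> A) (\<phi> B) (\<phi> C)"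
  shows "\<exists>U::'a \<Rightarrow> 'a. (unitary U \<or> antiunitary U) \<and>
           ((\<forall>A\<in>effects. blinfun_apply (\<phi> A) = U \<circ> blinfun_apply A \<circ> inv U) \<or>
            (\<forall>A\<in>effects. blinfun_apply (\<phi> A) = U \<circ> blinfun_apply (id_blinfun - A) \<circ> inv U))"
proof -
  have \<phi>: "mixture_automorphism \<phi>"
    using assms(2,3) by (simp add: mixture_automorphism_def)
  note ns = nonscalar_effect_exists[OF assms(1)]
  then have ne: "(id_blinfun :: 'a \<Rightarrow>\<^sub>L 'a) \<noteq> 0" using nonscalar_id_nonzero by blast
  have \<phi>_ne: "\<phi> 0 \<noteq> \<phi> id_blinfun"
    using mixture_automorphism_eq_iff[OF \<phi> zero_effect id_effect] ne by simp
  show ?thesis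
  proof (cases "\<phi> 0 = 0")
    case True
    then have "\<phi> id_blinfun = id_blinfun"
      using mixture_automorphism_0_or_id(2)[OF \<phi>] \<phi>_ne by auto
    then interpret unital_mixture_automorphism \<phi>
      using \<phi> True ns by unfold_locales
    show ?thesis using unitarily_implemented by blast
  next
    case False
    then have "\<phi> 0 = id_blinfun" "\<phi> id_blinfun = 0"
      using mixture_automorphism_0_or_id[OF \<phi>] \<phi>_ne by auto
    then interpret unital_mixture_automorphism "\<lambda>A. id_blinfun - \<phi> A"
      using mixture_automorphism_compl[OF \<phi>] ns by unfold_locales simp_all
    obtain U where U: "unitary U \<or> antiunitary U"
      and im: "\<And>A. A \<in> effects \<Longrightarrow> blinfun_apply (id_blinfun - \<phi> A) = U \<circ> blinfun_apply A \<circ> inv U"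
      using unitarily_implemented by blast
    have "blinfun_apply (\<phi> A) = U \<circ> blinfun_apply (id_blinfun - A) \<circ> inv U" if A: "A \<in> effects" for A
    proof -
      have "blinfun_apply (id_blinfun - \<phi> (id_blinfun - A)) = U \<circ> blinfun_apply (id_blinfun - A) \<circ> inv U"
        by (rule im) (simp add: A)
      moreover have "\<phi> A = id_blinfun - \<phi> (id_blinfun - A)"
        using image_compl[OF A] by (simp add: algebra_simps)
      ultimately show ?thesis by simp
    qed
    then show ?thesis using U by blast
  qed
qed

end
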